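(* Suppose that $\mathbb{E}\epsilon_i^4\le \nu<\infty$ for all $i$, where $\nu$ is a positive constant. Then the nested MMA estimator $\hat{\boldsymbol{\mu}}_{\hat{\mathbf{w}}_1|\mathcal{M}_G}$ based on the group-wise nested candidate set $\mathcal{M}_G$ satisfies, for any $\boldsymbol{\mu}=\sum_{j=1}^p\theta_j\boldsymbol{\psi}_j\in\mathbb{R}^n$, $$ \mathbb{E}L_n(\hat{\boldsymbol{\mu}}_{\hat{\mathbf{w}}_1|\mathcal{M}_G},\boldsymbol{\mu})\le [1+o(1)]\Bigl(1+\frac{1}{\log p}\Bigr)R_n(\hat{\boldsymbol{\mu}}_{\mathbf{w}^*|\mathcal{M}_{AN}},\boldsymbol{\mu})+\frac{C(\log p)^4}{n}, $$ where $C>0$ is a constant independent of $n$, and $o(1)$ is a quantity tending to $0$ as $n\to\infty$; neither $C$ nor the $o(1)$ term depends on $\boldsymbol{\mu}$.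
   Context: Model: $\mathbf{y}=\boldsymbol{\mu}+\boldsymbol{\epsilon}$ in $\mathbb{R}^n$, where $\boldsymbol{\epsilon}=(\epsilon_1,\dots,\epsilon_n)^\top$ has independent components with mean zero and variance $\sigma^2$ ($\sigma^2$ and $\nu$ do not depend on $n$). $\|\cdot\|$ is the Euclidean norm. For an estimator $\hat{\boldsymbol{\mu}}$ put $L_n(\hat{\boldsymbol{\mu}},\boldsymbol{\mu})=n^{-1}\|\hat{\boldsymbol{\mu}}-\boldsymbol{\mu}\|^2$ and $R_n(\hat{\boldsymbol{\mu}},\boldsymbol{\mu})=\mathbb{E}L_n(\hat{\boldsymbol{\mu}},\boldsymbol{\mu})$. Complete orthogonal basis: $\boldsymbol{\psi}_1,\dots,\boldsymbol{\psi}_p\in\mathbb{R}^n$ ($2\le p\le n$, $p$ may depend on $n$) are given with $n^{-1}\|\boldsymbol{\psi}_j\|^2=1$ and $\boldsymbol{\psi}_j^\top\boldsymbol{\psi}_{j'}=0$ for $j\ne j'$, and the true mean vector has the representation $\boldsymbol{\mu}=\sum_{j=1}^p\theta_j\boldsymbol{\psi}_j$, $\theta_j=\boldsymbol{\psi}_j^\top\boldsymbol{\mu}/n$. Candidate models: for $\mathcal{I}\subseteq\{1,\dots,p\}$ let $\mathbf{P}_{\mathcal{I}}$ be the orthogonal projection onto $\operatorname{span}\{\boldsymbol{\psi}_j:j\in\mathcal{I}\}$ and $\hat{\boldsymbol{\mu}}_{\mathcal{I}}=\mathbf{P}_{\mathcal{I}}\mathbf{y}$. For a finite collection $\mathcal{M}=\{\mathcal{I}_1,\dots,\mathcal{I}_M\}$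 of index sets let $\mathcal{W}=\{\mathbf{w}\in[0,1]^{M}:\sum_m w_m=1\}$, $\mathbf{P}(\mathbf{w})=\sum_m w_m\mathbf{P}_{\mathcal{I}_m}$, $\hat{\boldsymbol{\mu}}_{\mathbf{w}|\mathcal{M}}=\mathbf{P}(\mathbf{w})\mathbf{y}$, and $R_n(\hat{\boldsymbol{\mu}}_{\mathbf{w}^*|\mathcal{M}},\boldsymbol{\mu})=\min_{\mathbf{w}\in\mathcal{W}}R_n(\hat{\boldsymbol{\mu}}_{\mathbf{w}|\mathcal{M}},\boldsymbol{\mu})$ (minimum over deterministic $\mathbf{w}$). The MMA estimator based on $\mathcal{M}$ is $\hat{\boldsymbol{\mu}}_{\hat{\mathbf{w}}_1|\mathcal{M}}=\mathbf{P}(\hat{\mathbf{w}}_1)\mathbf{y}$ with $$\hat{\mathbf{w}}_1=\operatorname*{argmin}_{\mathbf{w}\in\mathcal{W}}\Bigl\{n^{-1}\|\mathbf{y}-\mathbf{P}(\mathbf{w})\mathbf{y}\|^2+\frac{2}{n}\hat{\sigma}^2\operatorname{tr}\mathbf{P}(\mathbf{w})\Bigr\},$$ where $\hat\sigma^2$ is an estimator of $\sigma^2$; it is assumed that $\sigma^2$ is known (and $\hat\sigma^2=\sigma^2$) or that $\mathbb{E}\hat\sigma^2=\sigma^2$. All nested models: $\mathcal{M}_{AN}=\{\{1\},\{1,2\},\dots,\{1,2,\dots,p\}\}$. Group-wise nested models: let $\rho_n=1/\log p$, $j_1=\lceil\log p\rceil$, $T_n=\min\bigl\{m\in\mathbb{N}: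 j_1+\sum_{t=2}^{m}\lfloor j_1(1+\rho_n)^{t-1}\rfloor\ge p\bigr\}$, $j_t=j_{t-1}+\lfloor j_1(1+\rho_n)^{t-1}\rfloor$ for $t=2,\dots,T_n-1$, and $j_{T_n}=p$. Then $\mathcal{M}_G=\{\{1,\dots,j_1\},\{1,\dots,j_2\},\dots,\{1,\dots,j_{T_n}\}\}$.
   Formalization: If σ̂² is only assumed unbiased (Eσ̂²=σ²), the claim is false (p=n−1, one residual degree of freedom, μ=0); in that case it is also assumed that σ̂² has finite variance with p·Var(σ̂²) ≤ Kσ⁴(log p)⁴, K independent of n and μ. The case of known σ² is unchanged. *)

theory Defs
  imports "HOL-Probability.Probability" "Jordan_Normal_Form.VS_Connect"
begin

text \<open>
  The sample size \<open>n\<close> varies inside the statement, so \<open>\<real>\<^sup>n\<close> is the carrier \<open>carrier_vec n\<close>, with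
  coordinates numbered from \<open>0\<close> to \<open>n - 1\<close>.  The basis vectors \<open>\<psi> j\<close> and the index sets are
  numbered from \<open>1\<close> to \<open>p\<close>.
\<close>

definition sqnorm :: "real vec \<Rightarrow> real" where
  "sqnorm v = scalar_prod v v"

definition trace :: "real mat \<Rightarrow> real" where
  "trace A = (\<Sum>i<dim_row A. A $$ (i, i))"

definition span_of :: "nat \<Rightarrow> real vec set \<Rightarrow> real vec set" where
  "span_of n S = LinearCombinations.module.span class_ring (module_vec TYPE(real) n) S"

definition is_orth_projection :: "nat \<Rightarrow> real vec set \<Rightarrow> real mat \<Rightarrow> bool" where
  "is_orth_projection n U P \<longleftrightarrow>
     P \<in> carrier_mat n n \<and>
     (\<forall>x\<in>carrier_vec n. P *\<^sub>v x \<in> U \<and> (\<forall>u\<in>U. scalar_prod (x - P *\<^sub>v x) u = 0))"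

definition orth_projection :: "nat \<Rightarrow> real vec set \<Rightarrow> real mat" where
  "orth_projection n U = (THE P. is_orth_projection n U P)"


subsection \<open>The regression model\<close>

definition orthogonal_design :: "nat \<Rightarrow> nat \<Rightarrow> (nat \<Rightarrow> real vec) \<Rightarrow> bool" where
  "orthogonal_design n p \<psi> \<longleftrightarrow>
     2 \<le> p \<and> p \<le> n \<and>
     (\<forall>j\<in>{1..p}. \<psi> j \<in> carrier_vec n \<and> sqnorm (\<psi> j) / real n = 1) \<and>
     (\<forall>j\<in>{1..p}. \<forall>k\<in>{1..p}. j \<noteq> k \<longrightarrow> scalar_prod (\<psi> j) (\<psi> k) = 0)"

definition mean_vec :: "nat \<Rightarrow> nat \<Rightarrow> (nat \<Rightarrow> real vec) \<Rightarrow> (nat \<Rightarrow> real) \<Rightarrow> real vec" where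
  "mean_vec n p \<psi> \<theta> = finsum_vec TYPE(real) n (\<lambda>j. \<theta> j \<cdot>\<^sub>v \<psi> j) {1..p}"

definition noise :: "'a measure \<Rightarrow> nat \<Rightarrow> (nat \<Rightarrow> 'a \<Rightarrow> real) \<Rightarrow> real \<Rightarrow> bool" where
  "noise M n \<epsilon> \<sigma> \<longleftrightarrow>
     prob_space M \<and>
     prob_space.indep_vars M (\<lambda>_. borel) \<epsilon> {..<n} \<and>
     (\<forall>i<n. integrable M (\<epsilon> i) \<and> integrable M (\<lambda>\<omega>. (\<epsilon> i \<omega>)\<^sup>2) \<and>
            prob_space.expectation M (\<epsilon> i) = 0 \<and>
            prob_space.variance M (\<epsilon> i) = \<sigma>\<^sup>2)"

definition obs :: "nat \<Rightarrow> (nat \<Rightarrow> 'a \<Rightarrow> real) \<Rightarrow> real vec \<Rightarrow> 'a \<Rightarrow> real vec" where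
  "obs n \<epsilon> \<mu> \<omega> = \<mu> + Matrix.vec n (\<lambda>i. \<epsilon> i \<omega>)"

definition loss :: "nat \<Rightarrow> real vec \<Rightarrow> real vec \<Rightarrow> real" where
  "loss n m \<mu> = sqnorm (m - \<mu>) / real n"

text \<open>An estimator is a function of the observed vector.\<close>

definition risk :: "'a measure \<Rightarrow> nat \<Rightarrow> (nat \<Rightarrow> 'a \<Rightarrow> real) \<Rightarrow> (real vec \<Rightarrow> real vec) \<Rightarrow> real vec \<Rightarrow> real" where
  "risk M n \<epsilon> est \<mu> = prob_space.expectation M (\<lambda>\<omega>. loss n (est (obs n \<epsilon> \<mu> \<omega>)) \<mu>)"


subsection \<open>Model averaging\<close>

text \<open>
  A candidate collection \<open>\<M>\<close> is a finite set of index sets; a weight vector assigns a weight to each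
  member of \<open>\<M>\<close>, and its values outside \<open>\<M>\<close> are irrelevant.
\<close>

definition weights :: "nat set set \<Rightarrow> (nat set \<Rightarrow> real) set" where
  "weights \<M> = {w. (\<forall>I\<in>\<M>. 0 \<le> w I \<and> w I \<le> 1) \<and> (\<Sum>I\<in>\<M>. w I) = 1}"

definition model_proj :: "nat \<Rightarrow> (nat \<Rightarrow> real vec) \<Rightarrow> nat set \<Rightarrow> real mat" where
  "model_proj n \<psi> I = orth_projection n (span_of n (\<psi> ` I))"

definition avg_proj :: "nat \<Rightarrow> (nat \<Rightarrow> real vec) \<Rightarrow> nat set set \<Rightarrow> (nat set \<Rightarrow> real) \<Rightarrow> real mat" where
  "avg_proj n \<psi> \<M> w = Matrix.mat n n (\<lambda>(i, k). \<Sum>I\<in>\<M>. w I * model_proj n \<psi> I $$ (i, k))"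

definition avg_est :: "nat \<Rightarrow> (nat \<Rightarrow> real vec) \<Rightarrow> nat set set \<Rightarrow> (nat set \<Rightarrow> real) \<Rightarrow> real vec \<Rightarrow> real vec" where
  "avg_est n \<psi> \<M> w y = avg_proj n \<psi> \<M> w *\<^sub>v y"

text \<open>
  The risk is a convex quadratic, hence continuous, function of the finitely many relevant weights,
  which range over a simplex, so the infimum is a minimum.
\<close>

definition oracle_risk ::
    "'a measure \<Rightarrow> nat \<Rightarrow> (nat \<Rightarrow> 'a \<Rightarrow> real) \<Rightarrow> (nat \<Rightarrow> real vec) \<Rightarrow> nat set set \<Rightarrow> real vec \<Rightarrow> real" where
  "oracle_risk M n \<epsilon> \<psi> \<M> \<mu> = (INF w\<in>weights \<M>. risk M n \<epsilon> (avg_est n \<psi> \<M> w) \<mu>)"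

definition mallows_criterion ::
    "nat \<Rightarrow> (nat \<Rightarrow> real vec) \<Rightarrow> nat set set \<Rightarrow> real \<Rightarrow> real vec \<Rightarrow> (nat set \<Rightarrow> real) \<Rightarrow> real" where
  "mallows_criterion n \<psi> \<M> s2 y w =
     sqnorm (y - avg_proj n \<psi> \<M> w *\<^sub>v y) / real n + 2 / real n * s2 * trace (avg_proj n \<psi> \<M> w)"

text \<open>
  The minimiser need not be unique for every \<open>y\<close> (for example \<open>y = 0\<close> and \<open>s2 y = 0\<close>), so minimality
  is a property of the weight rule \<open>w\<close> instead of a definition by choice, which need not be measurable.
\<close>

definition is_mma_weight_rule ::
    "nat \<Rightarrow> (nat \<Rightarrow> real vec) \<Rightarrow> nat set set \<Rightarrow> (real vec \<Rightarrow> real) \<Rightarrow> (real vec \<Rightarrow> nat set \<Rightarrow> real) \<Rightarrow> bool" where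
  "is_mma_weight_rule n \<psi> \<M> s2 w \<longleftrightarrow>
     (\<forall>y\<in>carrier_vec n. is_arg_min (mallows_criterion n \<psi> \<M> (s2 y) y) (\<lambda>v. v \<in> weights \<M>) (w y))"


subsection \<open>Candidate collections\<close>

definition all_nested :: "nat \<Rightarrow> nat set set" where
  "all_nested p = (\<lambda>m. {1..m}) ` {1..p}"

definition group_rho :: "nat \<Rightarrow> real" where
  "group_rho p = 1 / ln (real p)"

definition group_first :: "nat \<Rightarrow> nat" where
  "group_first p = nat \<lceil>ln (real p)\<rceil>"

definition group_partial :: "nat \<Rightarrow> nat \<Rightarrow> nat" where
  "group_partial p m =
     group_first p + (\<Sum>t=2..m. nat \<lfloor>real (group_first p) * (1 + group_rho p) ^ (t - 1)\<rfloor>)"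

definition group_count :: "nat \<Rightarrow> nat" where
  "group_count p = (LEAST m. 1 \<le> m \<and> p \<le> group_partial p m)"

text \<open>
  Below the last group, the recursion for the end points \<open>j\<^sub>t\<close> sums to the partial sums that define
  the number of groups.
\<close>

definition group_end :: "nat \<Rightarrow> nat \<Rightarrow> nat" where
  "group_end p t = (if t < group_count p then group_partial p t else p)"

definition group_nested :: "nat \<Rightarrow> nat set set" where
  "group_nested p = (\<lambda>t. {1..group_end p t}) ` {1..group_count p}"

end

theory Submission
  imports Defs
begin

text \<open>
  In the coordinates \<open>y\<^sub>j = \<psi>\<^sub>j \<cdot> y / n\<close>, a model average multiplies each \<open>y\<^sub>j\<close> by a factor \<open>\<gamma>\<^sub>j\<close>, the total
  weight of the models that contain \<open>j\<close> (called \<open>shrinkage\<close> below).  The loss becomes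
  \<open>\<Sum>\<^sub>j (\<gamma>\<^sub>j y\<^sub>j - \<theta>\<^sub>j)\<^sup>2\<close>, and Mallows' criterion becomes \<open>\<Sum>\<^sub>j \<gamma>\<^sub>j\<^sup>2 y\<^sub>j\<^sup>2 - 2 \<gamma>\<^sub>j (y\<^sub>j\<^sup>2 - s / n)\<close> plus a term without
  the weights, where \<open>s\<close> estimates \<open>\<sigma>\<^sup>2\<close>.  The inequality rests on three facts, and they give it
  even with \<open>0\<close> in place of the \<open>o(1)\<close> term.

  \<^emph>\<open>MMA is as good as any fixed weights, up to \<open>O(1/n)\<close> per group\<close> (\<open>mma_oracle_inequality\<close>).  Loss and
  criterion are quadratic in \<open>\<gamma>\<close> with the same curvature \<open>y\<^sub>j\<^sup>2\<close>.  Minimality over a convex set therefore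
  yields, beyond the comparison of the criteria, the negative term \<open>- \<Sum>\<^sub>j y\<^sub>j\<^sup>2 d\<^sub>j\<^sup>2\<close>, where \<open>d\<close> is the difference
  of the factors (\<open>mma_loss_le\<close>).  The gap between loss and criterion is linear in \<open>d\<close>.  For nested models
  \<open>d\<close> is constant on each block between two consecutive model sizes, so on a block this gap is one number
  times a centred noise variable.  The variance of that variable is at most \<open>O(1/n)\<close> times the expected
  curvature of the block, so completing the square costs \<open>O(1/n)\<close>, however large the signal is
  (\<open>block_excess_bound\<close>, \<open>excess_expectation\<close>).  The fourth moments enter through the variance of a quadratic
  form in the noise (\<open>quad_second_moment\<close>).  The error of \<open>s\<close> is absorbed by the same curvature and costs
  a multiple of \<open>p Var(s) / (n \<sigma>\<^sup>2)\<close> in total, which the assumption on \<open>s\<close> bounds by a multiple of \<open>(log p)\<^sup>4 / n\<close>.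

  \<^emph>\<open>Grouping costs the factor \<open>1 + 1 / log p\<close>\<close> (\<open>risk_round_up\<close>).  Given weights on all nested models, move the
  weight of \<open>{1..j}\<close> to the smallest group model that contains it.  The factors can only grow, so the bias
  falls.  On each block the new factor is the old factor at the first coordinate of the block; summation by
  parts reduces the growth of the variance to the recursion \<open>j\<^sub>t\<^sub>+\<^sub>1 \<le> (1 + \<rho>) j\<^sub>t + D\<close> for the group ends
  (\<open>sum_block_shift_le\<close>).  All rounding effects of the floors and the whole first group go into
  \<open>D = O((log p)\<^sup>4)\<close>.

  \<^emph>\<open>There are few groups\<close> (\<open>group_count_le\<close>).  The groups grow geometrically with ratio \<open>1 + 1 / log p\<close>, so
  their number is \<open>O((log p)\<^sup>2)\<close>, and the cost of the first fact is \<open>O((log p)\<^sup>4 / n)\<close>.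
\<close>


section \<open>Model averages in the coordinates of an orthogonal basis\<close>

text \<open>
  The factor by which the average multiplies the coordinate \<open>j\<close>: see \<open>avg_est_eq\<close> below.
\<close>
definition shrinkage :: "nat set set \<Rightarrow> (nat set \<Rightarrow> real) \<Rightarrow> nat \<Rightarrow> real" where
  "shrinkage \<M> w j = (\<Sum>I\<in>{I\<in>\<M>. j \<in> I}. w I)"

text \<open>
  The two images of a vector differ by an element of \<open>U\<close> that is orthogonal to itself.
\<close>
lemma is_orth_projection_unique:
  assumes P: "is_orth_projection n U P" and Q: "is_orth_projection n U Q"
    and U: "U \<subseteq> carrier_vec n" and diff: "\<And>u v. u \<in> U \<Longrightarrow> v \<in> U \<Longrightarrow> u - v \<in> U"
  shows "P = Q"
proof (rule eq_matI)
  have PC: "P \<in> carrier_mat n n" and QC: "Q \<in> carrier_mat n n"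
    using P Q by (auto simp: is_orth_projection_def)
  show "dim_row P = dim_row Q" "dim_col P = dim_col Q" using PC QC by auto
  fix i k assume "i < dim_row Q" "k < dim_col Q"
  then have ik: "i < n" "k < n" using QC by auto
  have "P *\<^sub>v x = Q *\<^sub>v x" if x: "x \<in> carrier_vec n" for x
  proof -
    define d where "d = P *\<^sub>v x - Q *\<^sub>v x"
    have Px: "P *\<^sub>v x \<in> U" "P *\<^sub>v x \<in> carrier_vec n" and Qx: "Q *\<^sub>v x \<in> U" "Q *\<^sub>v x \<in> carrier_vec n"
      using P Q x U by (auto simp: is_orth_projection_def)
    have dU: "d \<in> U" unfolding d_def using Px Qx diff by auto
    then have dC: "d \<in> carrier_vec n" using U by auto
    have "scalar_prod (x - P *\<^sub>v x) d = 0" "scalar_prod (x - Q *\<^sub>v x) d = 0"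
      using P Q x dU by (auto simp: is_orth_projection_def)
    moreover have "d = (x - Q *\<^sub>v x) - (x - P *\<^sub>v x)"
      unfolding d_def using carrier_vecD[OF x] carrier_vecD[OF Px(2)] carrier_vecD[OF Qx(2)]
      by (intro eq_vecI) (simp_all del: index_mult_mat_vec dim_mult_mat_vec)
    ultimately have "scalar_prod d d = 0"
      using x Px Qx dC minus_scalar_prod_distrib[of "x - Q *\<^sub>v x" n "x - P *\<^sub>v x" d] by auto
    then have "(\<Sum>i\<in>{0..<n}. (vec_index d i)\<^sup>2) = 0"
      using dC by (simp add: scalar_prod_def power2_eq_square)
    then have d0: "\<forall>i\<in>{0..<n}. (vec_index d i)\<^sup>2 = 0"
      by (subst (asm) sum_nonneg_eq_0_iff) auto
    show ?thesis
    proof (rule eq_vecI)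
      show "dim_vec (P *\<^sub>v x) = dim_vec (Q *\<^sub>v x)"
        using carrier_vecD[OF Px(2)] carrier_vecD[OF Qx(2)] by simp
      fix i assume "i < dim_vec (Q *\<^sub>v x)"
      then show "vec_index (P *\<^sub>v x) i = vec_index (Q *\<^sub>v x) i"
        using d0[rule_format, of i] carrier_vecD[OF Qx(2)] unfolding d_def by (simp del: index_mult_mat_vec dim_mult_mat_vec)
    qed
  qed
  from this[of "unit_vec n k"] have "P *\<^sub>v unit_vec n k = Q *\<^sub>v unit_vec n k" by simp
  then have "vec_index (P *\<^sub>v unit_vec n k) i = vec_index (Q *\<^sub>v unit_vec n k) i" by simp
  then show "P $$ (i, k) = Q $$ (i, k)" using PC QC ik by simp
qed

locale orthogonal_regression =
  fixes n p :: nat and \<psi> :: "nat \<Rightarrow> real vec"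
  assumes design: "orthogonal_design n p \<psi>"
begin

abbreviation entry :: "nat \<Rightarrow> nat \<Rightarrow> real" where
  "entry j i \<equiv> vec_index (\<psi> j) i"

definition comb :: "(nat \<Rightarrow> real) \<Rightarrow> real vec" where
  "comb a = Matrix.vec n (\<lambda>i. \<Sum>j=1..p. a j * entry j i)"

definition coord :: "nat \<Rightarrow> real vec \<Rightarrow> real" where
  "coord j y = scalar_prod (\<psi> j) y / real n"

lemma dims: "2 \<le> p" "p \<le> n" "0 < n"
  using design by (auto simp: orthogonal_design_def)

lemma basis_carrier: "j \<in> {1..p} \<Longrightarrow> \<psi> j \<in> carrier_vec n"
  using design by (auto simp: orthogonal_design_def)

lemma entry_orthogonal:
  assumes "j \<in> {1..p}" "k \<in> {1..p}"
  shows "(\<Sum>i<n. entry j i * entry k i) = (if j = k then real n else 0)"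
proof -
  have "scalar_prod (\<psi> j) (\<psi> k) = (if j = k then real n else 0)"
    using design assms dims by (auto simp: orthogonal_design_def sqnorm_def)
  moreover have "dim_vec (\<psi> k) = n" using basis_carrier assms by auto
  ultimately show ?thesis by (simp add: scalar_prod_def lessThan_atLeast0)
qed

lemma comb_carrier [simp]: "comb a \<in> carrier_vec n"
  by (simp add: comb_def)

lemma coord_eq: "y \<in> carrier_vec n \<Longrightarrow> coord j y = (\<Sum>i<n. entry j i * vec_index y i) / real n"
  by (simp add: coord_def scalar_prod_def lessThan_atLeast0)

lemma coord_add: "j \<in> {1..p} \<Longrightarrow> x \<in> carrier_vec n \<Longrightarrow> y \<in> carrier_vec n \<Longrightarrow>
    coord j (x + y) = coord j x + coord j y"
  by (simp add: coord_def scalar_prod_add_distrib[OF basis_carrier] add_divide_distrib)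

lemma scalar_prod_comb:
  assumes "y \<in> carrier_vec n"
  shows "scalar_prod (comb a) y = real n * (\<Sum>j=1..p. a j * coord j y)"
proof -
  have "scalar_prod (comb a) y = (\<Sum>i<n. (\<Sum>j=1..p. a j * entry j i) * vec_index y i)"
    using assms by (simp add: scalar_prod_def comb_def lessThan_atLeast0)
  also have "\<dots> = (\<Sum>j=1..p. \<Sum>i<n. a j * (entry j i * vec_index y i))"
    by (subst sum.swap) (simp add: sum_distrib_right mult.assoc)
  also have "\<dots> = (\<Sum>j=1..p. a j * (real n * coord j y))"
    using assms dims by (simp add: coord_eq sum_distrib_left[symmetric])
  finally show ?thesis by (simp add: sum_distrib_left mult_ac)
qed

lemma coord_comb: "j \<in> {1..p} \<Longrightarrow> coord j (comb a) = a j"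
proof -
  assume j: "j \<in> {1..p}"
  have "coord j (comb a) = (\<Sum>i<n. entry j i * (\<Sum>k=1..p. a k * entry k i)) / real n"
    by (simp add: coord_eq comb_def)
  also have "(\<Sum>i<n. entry j i * (\<Sum>k=1..p. a k * entry k i)) = (\<Sum>k=1..p. a k * (\<Sum>i<n. entry j i * entry k i))"
    by (simp only: sum_distrib_left) (subst sum.swap, simp add: mult_ac)
  also have "\<dots> = (\<Sum>k=1..p. if j = k then a k * real n else 0)"
    using j by (intro sum.cong refl) (simp add: entry_orthogonal del: sum.delta)
  also have "\<dots> = a j * real n" using j by (subst sum.delta') auto
  finally show ?thesis using dims by simp
qed

lemma sqnorm_comb: "sqnorm (comb a) = real n * (\<Sum>j=1..p. (a j)\<^sup>2)"
  by (simp add: sqnorm_def scalar_prod_comb coord_comb power2_eq_square)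

lemma comb_diff: "comb a - comb b = comb (\<lambda>j. a j - b j)"
  by (intro eq_vecI) (auto simp: comb_def sum_subtractf[symmetric] algebra_simps)

lemma mean_vec_comb: "mean_vec n p \<psi> \<theta> = comb \<theta>"
proof (rule eq_vecI)
  have c: "(\<lambda>j. \<theta> j \<cdot>\<^sub>v \<psi> j) \<in> {1..p} \<rightarrow> carrier_vec n"
    using basis_carrier by auto
  have "mean_vec n p \<psi> \<theta> \<in> carrier_vec n"
    unfolding mean_vec_def using c by (intro finsum_vec_closed)
  then show "dim_vec (mean_vec n p \<psi> \<theta>) = dim_vec (comb \<theta>)" by (simp add: comb_def)
  fix i assume "i < dim_vec (comb \<theta>)"
  then have i: "i < n" by (simp add: comb_def)
  then show "vec_index (mean_vec n p \<psi> \<theta>) i = vec_index (comb \<theta>) i"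
    unfolding mean_vec_def
    by (subst index_finsum_vec[OF _ i]) (use c i carrier_vecD[OF basis_carrier] in \<open>auto simp: comb_def intro!: sum.cong\<close>)
qed

lemma comb_in_span:
  assumes "I \<subseteq> {1..p}"
  shows "comb (\<lambda>j. if j \<in> I then a j else 0) \<in> span_of n (\<psi> ` I)"
proof -
  interpret vec_space "TYPE(real)" n .
  have S: "\<psi> ` I \<subseteq> carrier_vec n" using assms basis_carrier by auto
  have "Matrix.vec n (\<lambda>i. \<Sum>j\<in>F. a j * entry j i) \<in> span (\<psi> ` I)" if "finite F" "F \<subseteq> I" for F
    using that
  proof (induction F)
    case empty
    have "Matrix.vec n (\<lambda>i. \<Sum>j\<in>{}. a j * entry j i) = 0\<^sub>v n" by (intro eq_vecI) auto
    then show ?case by (simp add: span_zero)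
  next
    case (insert k F)
    have "k \<in> {1..p}" using insert assms by auto
    then have "Matrix.vec n (\<lambda>i. \<Sum>j\<in>insert k F. a j * entry j i)
        = a k \<cdot>\<^sub>v \<psi> k + Matrix.vec n (\<lambda>i. \<Sum>j\<in>F. a j * entry j i)"
      using insert basis_carrier[of k] by (intro eq_vecI) auto
    moreover have "a k \<cdot>\<^sub>v \<psi> k \<in> span (\<psi> ` I)"
      using insert S by (intro smult_in_span in_own_span[THEN subsetD]) auto
    ultimately show ?case using insert span_add1[OF S] by auto
  qed
  moreover have "finite I" using assms finite_subset by blast
  ultimately have "Matrix.vec n (\<lambda>i. \<Sum>j\<in>I. a j * entry j i) \<in> span (\<psi> ` I)" by blast
  moreover have "Matrix.vec n (\<lambda>i. \<Sum>j\<in>I. a j * entry j i) = comb (\<lambda>j. if j \<in> I then a j else 0)"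
  proof (intro eq_vecI)
    fix i assume "i < dim_vec (comb (\<lambda>j. if j \<in> I then a j else 0))"
    then have "i < n" by (simp add: comb_def)
    moreover have "(\<Sum>j\<in>I. a j * entry j i) = (\<Sum>j=1..p. (if j \<in> I then a j else 0) * entry j i)"
      using assms by (intro sum.mono_neutral_cong_left) auto
    ultimately show "vec_index (Matrix.vec n (\<lambda>i. \<Sum>j\<in>I. a j * entry j i)) i
        = vec_index (comb (\<lambda>j. if j \<in> I then a j else 0)) i" by (simp add: comb_def)
  qed (simp add: comb_def)
  ultimately show ?thesis by (simp add: span_of_def)
qed

lemma span_orthogonal:
  assumes "I \<subseteq> {1..p}" "x \<in> carrier_vec n" "\<And>j. j \<in> I \<Longrightarrow> scalar_prod x (\<psi> j) = 0"
    and u: "u \<in> span_of n (\<psi> ` I)"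
  shows "scalar_prod x u = 0"
proof -
  interpret vec_space "TYPE(real)" n .
  obtain a A where u: "u = lincomb a A" "finite A" "A \<subseteq> \<psi> ` I"
    using u unfolding span_of_def span_def by auto
  have "\<psi> ` I \<subseteq> carrier_vec n" using assms(1) basis_carrier by auto
  with u(3) have A: "A \<subseteq> carrier_vec n" by (rule subset_trans)
  have "scalar_prod u x = (\<Sum>v\<in>A. scalar_prod (a v \<cdot>\<^sub>v v) x)"
    unfolding u lincomb_def using A assms(2) by (subst finsum_scalar_prod_sum) auto
  also have "\<dots> = 0"
  proof (intro sum.neutral ballI)
    fix v assume v: "v \<in> A"
    then obtain j where "j \<in> I" "v = \<psi> j" using u by auto
    then have "scalar_prod v x = 0"
      using assms(2,3) v A by (metis comm_scalar_prod subsetD)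
    then show "scalar_prod (a v \<cdot>\<^sub>v v) x = 0" using v A assms(2) by (metis mult_zero_right smult_scalar_prod_distrib subsetD)
  qed
  finally show ?thesis
    using u A assms(2) by (metis comm_scalar_prod lincomb_closed)
qed

text \<open>
  The matrix on the right maps \<open>x\<close> to the combination of the \<open>\<psi> j\<close>, \<open>j \<in> I\<close>, with the coordinates of \<open>x\<close> as
  coefficients.  This lies in the span, and the residual is orthogonal to each basis vector in \<open>I\<close>; by uniqueness
  it is the projection.
\<close>
lemma model_proj_eq:
  assumes I: "I \<subseteq> {1..p}"
  shows "model_proj n \<psi> I = Matrix.mat n n (\<lambda>(i, k). \<Sum>j\<in>I. entry j i * entry j k / real n)"
proof -
  define P where "P = Matrix.mat n n (\<lambda>(i, k). \<Sum>j\<in>I. entry j i * entry j k / real n)"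
  interpret V: vec_space "TYPE(real)" n .
  let ?U = "span_of n (\<psi> ` I)"
  have S: "\<psi> ` I \<subseteq> carrier_vec n" using I basis_carrier by auto
  have finI: "finite I" using I finite_subset by blast
  have Px: "P *\<^sub>v x = comb (\<lambda>j. if j \<in> I then coord j x else 0)" if x: "x \<in> carrier_vec n" for x
  proof (intro eq_vecI)
    fix i assume "i < dim_vec (comb (\<lambda>j. if j \<in> I then coord j x else 0))"
    then have i: "i < n" by (simp add: comb_def)
    then have "vec_index (P *\<^sub>v x) i = (\<Sum>k<n. (\<Sum>j\<in>I. entry j i * entry j k / real n) * vec_index x k)"
      using x by (simp add: P_def scalar_prod_def lessThan_atLeast0 del: times_divide_eq_left)
    also have "\<dots> = (\<Sum>k<n. \<Sum>j\<in>I. entry j i * (entry j k * vec_index x k) / real n)"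
      by (intro sum.cong refl) (simp only: sum_distrib_right times_divide_eq_left mult.assoc)
    also have "\<dots> = (\<Sum>j\<in>I. \<Sum>k<n. entry j i * (entry j k * vec_index x k) / real n)"
      by (rule sum.swap)
    also have "\<dots> = (\<Sum>j\<in>I. coord j x * entry j i)"
    proof (intro sum.cong refl)
      fix j
      have "(\<Sum>k<n. entry j i * (entry j k * vec_index x k) / real n) = entry j i * (\<Sum>k<n. entry j k * vec_index x k) / real n"
        by (simp only: sum_distrib_left sum_divide_distrib)
      then show "(\<Sum>k<n. entry j i * (entry j k * vec_index x k) / real n) = coord j x * entry j i"
        unfolding coord_eq[OF x] by simp
    qed
    also have "\<dots> = (\<Sum>j=1..p. (if j \<in> I then coord j x else 0) * entry j i)"
      using I by (intro sum.mono_neutral_cong_left) auto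
    finally show "vec_index (P *\<^sub>v x) i = vec_index (comb (\<lambda>j. if j \<in> I then coord j x else 0)) i"
      using i by (simp add: comb_def)
  qed (simp add: comb_def P_def)
  have orth: "is_orth_projection n ?U P"
    unfolding is_orth_projection_def
  proof (intro conjI ballI)
    show "P \<in> carrier_mat n n" by (simp add: P_def)
    fix x :: "real vec" assume x: "x \<in> carrier_vec n"
    show "P *\<^sub>v x \<in> ?U" unfolding Px[OF x] by (rule comb_in_span[OF I])
    fix u assume u: "u \<in> ?U"
    have orth_basis: "scalar_prod (x - P *\<^sub>v x) (\<psi> j) = 0" if j: "j \<in> I" for j
    proof -
      have jp: "j \<in> {1..p}" using j I by auto
      note c = basis_carrier[OF jp]
      have "real n * coord j (P *\<^sub>v x) = real n * coord j x"
        unfolding Px[OF x] using j jp by (simp add: coord_comb)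
      then have "scalar_prod (\<psi> j) (P *\<^sub>v x) = scalar_prod (\<psi> j) x"
        using dims by (simp add: coord_def)
      moreover have PC: "P *\<^sub>v x \<in> carrier_vec n" unfolding Px[OF x] by simp
      ultimately show ?thesis
        unfolding minus_scalar_prod_distrib[OF x PC c] comm_scalar_prod[OF PC c] comm_scalar_prod[OF x c] by simp
    qed
    have "x - P *\<^sub>v x \<in> carrier_vec n"
      unfolding Px[OF x] using x comb_carrier by (rule minus_carrier_vec)
    then show "scalar_prod (x - P *\<^sub>v x) u = 0"
      by (rule span_orthogonal[OF I _ orth_basis u])
  qed
  have U: "?U \<subseteq> carrier_vec n"
    unfolding span_of_def using V.span_is_subset2[OF S] by simp
  have diff: "u - v \<in> ?U" if "u \<in> ?U" "v \<in> ?U" for u v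
  proof -
    have "u \<in> carrier_vec n" "v \<in> carrier_vec n" using that U by blast+
    then have "u - v = u + (-1) \<cdot>\<^sub>v v" by (intro eq_vecI) auto
    moreover have "(-1) \<cdot>\<^sub>v v \<in> ?U"
      unfolding span_of_def by (rule V.smult_in_span[OF S that(2)[unfolded span_of_def]])
    ultimately show ?thesis
      using V.span_add1[OF S, of u "(-1) \<cdot>\<^sub>v v"] that(1) unfolding span_of_def by simp
  qed
  have "(THE P. is_orth_projection n ?U P) = P"
  proof (rule the_equality, rule orth)
    fix Q assume "is_orth_projection n ?U Q"
    then show "Q = P" by (rule is_orth_projection_unique[OF _ orth U diff])
  qed
  then show ?thesis by (simp add: model_proj_def orth_projection_def P_def)
qed

lemma avg_proj_entry:
  assumes "finite \<M>" "\<M> \<subseteq> Pow {1..p}" "i < n" "k < n"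
  shows "avg_proj n \<psi> \<M> w $$ (i, k) = (\<Sum>j=1..p. shrinkage \<M> w j * (entry j i * entry j k / real n))"
proof -
  let ?e = "\<lambda>j. entry j i * entry j k / real n"
  have sub: "I \<subseteq> {1..p}" if "I \<in> \<M>" for I using assms(2) that by blast
  have "w I * model_proj n \<psi> I $$ (i, k) = (\<Sum>j=1..p. if j \<in> I then w I * ?e j else 0)" if I: "I \<in> \<M>" for I
  proof -
    have "w I * model_proj n \<psi> I $$ (i, k) = (\<Sum>j\<in>I. w I * ?e j)"
      using assms(3,4) unfolding model_proj_eq[OF sub[OF I]] sum_distrib_left[symmetric] by simp
    also have "\<dots> = (\<Sum>j=1..p. if j \<in> I then w I * ?e j else 0)"
      using sub[OF I] by (intro sum.mono_neutral_cong_left) auto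
    finally show ?thesis .
  qed
  then have "avg_proj n \<psi> \<M> w $$ (i, k) = (\<Sum>I\<in>\<M>. \<Sum>j=1..p. if j \<in> I then w I * ?e j else 0)"
    using assms(3,4) by (simp add: avg_proj_def)
  also have "\<dots> = (\<Sum>j=1..p. \<Sum>I\<in>\<M>. if j \<in> I then w I * ?e j else 0)"
    by (rule sum.swap)
  also have "\<dots> = (\<Sum>j=1..p. shrinkage \<M> w j * ?e j)"
    unfolding shrinkage_def sum_distrib_right
    by (rule sum.cong[OF refl]) (rule sum.inter_filter[symmetric, OF assms(1)])
  finally show ?thesis .
qed

lemma avg_est_eq:
  assumes "finite \<M>" "\<M> \<subseteq> Pow {1..p}" and y: "y \<in> carrier_vec n"
  shows "avg_est n \<psi> \<M> w y = comb (\<lambda>j. shrinkage \<M> w j * coord j y)"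
proof (intro eq_vecI)
  fix i assume "i < dim_vec (comb (\<lambda>j. shrinkage \<M> w j * coord j y))"
  then have i: "i < n" by (simp add: comb_def)
  have "vec_index (avg_est n \<psi> \<M> w y) i = (\<Sum>k<n. avg_proj n \<psi> \<M> w $$ (i, k) * vec_index y k)"
    using i y by (simp add: avg_est_def scalar_prod_def lessThan_atLeast0 avg_proj_def)
  also have "\<dots> = (\<Sum>j=1..p. \<Sum>k<n. shrinkage \<M> w j * (entry j i * entry j k / real n) * vec_index y k)"
  proof -
    have "(\<Sum>k<n. avg_proj n \<psi> \<M> w $$ (i, k) * vec_index y k)
        = (\<Sum>k<n. \<Sum>j=1..p. shrinkage \<M> w j * (entry j i * entry j k / real n) * vec_index y k)"
      using i assms(1,2) by (intro sum.cong refl) (simp only: avg_proj_entry lessThan_iff sum_distrib_right)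
    also have "\<dots> = (\<Sum>j=1..p. \<Sum>k<n. shrinkage \<M> w j * (entry j i * entry j k / real n) * vec_index y k)"
      by (rule sum.swap)
    finally show ?thesis .
  qed
  also have "\<dots> = (\<Sum>j=1..p. shrinkage \<M> w j * coord j y * entry j i)"
  proof (intro sum.cong refl)
    fix j
    have "(\<Sum>k<n. shrinkage \<M> w j * (entry j i * entry j k / real n) * vec_index y k)
        = (\<Sum>k<n. (shrinkage \<M> w j * entry j i / real n) * (entry j k * vec_index y k))"
      by (intro sum.cong refl) simp
    also have "\<dots> = (shrinkage \<M> w j * entry j i / real n) * (\<Sum>k<n. entry j k * vec_index y k)"
      by (simp only: sum_distrib_left)
    finally show "(\<Sum>k<n. shrinkage \<M> w j * (entry j i * entry j k / real n) * vec_index y k)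
        = shrinkage \<M> w j * coord j y * entry j i"
      unfolding coord_eq[OF y] by simp
  qed
  finally show "vec_index (avg_est n \<psi> \<M> w y) i = vec_index (comb (\<lambda>j. shrinkage \<M> w j * coord j y)) i"
    using i by (simp add: comb_def)
qed (simp add: comb_def avg_est_def avg_proj_def)

text \<open>
  Each rank one matrix \<open>\<psi>\<^sub>j \<psi>\<^sub>j\<^sup>T / n\<close> has trace one.
\<close>
lemma trace_avg_proj:
  assumes "finite \<M>" "\<M> \<subseteq> Pow {1..p}"
  shows "trace (avg_proj n \<psi> \<M> w) = (\<Sum>j=1..p. shrinkage \<M> w j)"
proof -
  have "trace (avg_proj n \<psi> \<M> w) = (\<Sum>i<n. avg_proj n \<psi> \<M> w $$ (i, i))"
    by (simp add: trace_def avg_proj_def)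
  also have "\<dots> = (\<Sum>i<n. \<Sum>j=1..p. shrinkage \<M> w j * (entry j i * entry j i / real n))"
    using assms by (intro sum.cong refl avg_proj_entry) auto
  also have "\<dots> = (\<Sum>j=1..p. shrinkage \<M> w j * ((\<Sum>i<n. entry j i * entry j i) / real n))"
    by (subst sum.swap) (simp only: sum_distrib_left sum_divide_distrib)
  also have "\<dots> = (\<Sum>j=1..p. shrinkage \<M> w j)"
    using dims by (intro sum.cong refl) (subst entry_orthogonal, auto)
  finally show ?thesis .
qed

lemma loss_avg_est:
  assumes "finite \<M>" "\<M> \<subseteq> Pow {1..p}" and y: "y \<in> carrier_vec n"
  shows "loss n (avg_est n \<psi> \<M> w y) (comb \<theta>) = (\<Sum>j=1..p. (shrinkage \<M> w j * coord j y - \<theta> j)\<^sup>2)"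
  using assms dims by (simp add: loss_def avg_est_eq comb_diff sqnorm_comb)

text \<open>
  Only the second summand depends on \<open>w\<close>; as a function of the shrinkage factors it has the curvature
  \<open>(coord j y)\<^sup>2\<close> of the loss in \<open>loss_avg_est\<close>.
\<close>
lemma mallows_criterion_eq:
  assumes "finite \<M>" "\<M> \<subseteq> Pow {1..p}" and y: "y \<in> carrier_vec n"
  shows "mallows_criterion n \<psi> \<M> s2 y w = sqnorm y / real n +
    (\<Sum>j=1..p. (shrinkage \<M> w j)\<^sup>2 * (coord j y)\<^sup>2
      - 2 * shrinkage \<M> w j * ((coord j y)\<^sup>2 - s2 / real n))"
proof -
  let ?g = "shrinkage \<M> w"
  define v where "v = comb (\<lambda>j. ?g j * coord j y)"
  have v: "v \<in> carrier_vec n" by (simp add: v_def)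
  have "sqnorm (y - v) = sqnorm y - 2 * scalar_prod v y + sqnorm v"
    using y v by (simp add: sqnorm_def minus_scalar_prod_distrib[of y n v] scalar_prod_minus_distrib[of y n y v]
        scalar_prod_minus_distrib[of v n y v] comm_scalar_prod[of y n v])
  also have "scalar_prod v y = real n * (\<Sum>j=1..p. ?g j * (coord j y)\<^sup>2)"
    unfolding v_def scalar_prod_comb[OF y] by (simp add: power2_eq_square mult.assoc)
  also have "sqnorm v = real n * (\<Sum>j=1..p. (?g j)\<^sup>2 * (coord j y)\<^sup>2)"
    by (simp add: v_def sqnorm_comb power_mult_distrib)
  finally have "sqnorm (y - v) / real n = sqnorm y / real n
      - 2 * (\<Sum>j=1..p. ?g j * (coord j y)\<^sup>2) + (\<Sum>j=1..p. (?g j)\<^sup>2 * (coord j y)\<^sup>2)"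
    using dims by (simp add: field_simps)
  moreover have "avg_proj n \<psi> \<M> w *\<^sub>v y = v"
    using avg_est_eq[OF assms] by (simp add: avg_est_def v_def)
  moreover have "2 / real n * s2 * trace (avg_proj n \<psi> \<M> w) = (\<Sum>j=1..p. 2 * ?g j * (s2 / real n))"
    by (simp only: trace_avg_proj[OF assms(1,2)] sum_distrib_left) (rule sum.cong[OF refl], simp)
  ultimately have "mallows_criterion n \<psi> \<M> s2 y w = sqnorm y / real n
      + ((\<Sum>j=1..p. (?g j)\<^sup>2 * (coord j y)\<^sup>2) - (\<Sum>j=1..p. 2 * (?g j * (coord j y)\<^sup>2))
      + (\<Sum>j=1..p. 2 * ?g j * (s2 / real n)))"
    unfolding mallows_criterion_def sum_distrib_left[symmetric] by simp
  also have "(\<Sum>j=1..p. (?g j)\<^sup>2 * (coord j y)\<^sup>2) - (\<Sum>j=1..p. 2 * (?g j * (coord j y)\<^sup>2))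
      + (\<Sum>j=1..p. 2 * ?g j * (s2 / real n))
    = (\<Sum>j=1..p. (?g j)\<^sup>2 * (coord j y)\<^sup>2 - 2 * ?g j * ((coord j y)\<^sup>2 - s2 / real n))"
    unfolding sum_subtractf[symmetric] sum.distrib[symmetric]
    by (intro sum.cong refl) (simp add: right_diff_distrib)
  finally show ?thesis .
qed

end

section \<open>Sums over blocks and the sizes of the groups\<close>

lemma sum_blocks:
  fixes J :: "nat \<Rightarrow> nat" and f :: "nat \<Rightarrow> real"
  assumes "J 0 = 0" "\<And>t. t < m \<Longrightarrow> J t \<le> J (Suc t)"
  shows "(\<Sum>j=1..J m. f j) = (\<Sum>t<m. \<Sum>j\<in>{J t<..J (Suc t)}. f j)"
  using assms(2)
proof (induction m)
  case (Suc m)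
  have "{1..J (Suc m)} = {1..J m} \<union> {J m<..J (Suc m)}" using Suc.prems[of m] by auto
  then have "(\<Sum>j=1..J (Suc m). f j) = (\<Sum>j=1..J m. f j) + (\<Sum>j\<in>{J m<..J (Suc m)}. f j)"
    by (simp only:) (subst sum.union_disjoint, auto)
  then show ?case using Suc by simp
qed (simp add: assms(1))

text \<open>
  Summation by parts.  The coefficient \<open>J (Suc t) - (1 + \<rho>) * J t - D\<close> is at most \<open>0\<close> and \<open>h\<close> decreases, so
  replacing \<open>h t\<close> by \<open>h (Suc t)\<close> next to it only increases the product.  The induction carries this product along
  as a last summand and drops it at the end.
\<close>
lemma sum_block_shift_le:
  fixes J h :: "nat \<Rightarrow> real"
  assumes J0: "J 0 = 0" and step: "\<And>t. t \<le> m \<Longrightarrow> J (Suc t) \<le> (1 + \<rho>) * J t + D"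
    and h: "\<And>t. t < m \<Longrightarrow> h (Suc t) \<le> h t" "0 \<le> h m"
  shows "(\<Sum>t<Suc m. (J (Suc t) - J t) * h t) \<le> (1 + \<rho>) * (\<Sum>t<m. (J (Suc t) - J t) * h (Suc t)) + D * h 0"
proof -
  \<comment> \<open>the last summand makes the induction go through; it is nonpositive for \<open>k = m\<close>\<close>
  have "(\<Sum>t<Suc k. (J (Suc t) - J t) * h t) \<le> (1 + \<rho>) * (\<Sum>t<k. (J (Suc t) - J t) * h (Suc t)) + D * h 0
      + (J (Suc k) - (1 + \<rho>) * J k - D) * h k" if "k \<le> m" for k
    using that
  proof (induction k)
    case (Suc k)
    have "0 \<le> (J (Suc k) - (1 + \<rho>) * J k - D) * (h (Suc k) - h k)"
      using step[of k] h(1)[of k] Suc.prems by (intro mult_nonpos_nonpos) auto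
    then show ?case using Suc by (simp add: algebra_simps)
  qed (simp add: J0 algebra_simps)
  from this[of m] mult_nonpos_nonneg[OF _ h(2), of "J (Suc m) - (1 + \<rho>) * J m - D"] step[of m]
  show ?thesis by auto
qed

lemma ln_ge_half: "2 \<le> p \<Longrightarrow> 1 / 2 \<le> ln (real p)"
proof -
  assume p: "2 \<le> p"
  have "ln (1 / 2) \<le> (1 / 2 :: real) - 1" by (rule ln_le_minus_one) simp
  then have "1 / 2 \<le> ln (2 :: real)" by (simp add: ln_div)
  also have "\<dots> \<le> ln (real p)" using p by simp
  finally show ?thesis .
qed

text \<open>
  The group ends, preceded by \<open>0\<close>, so that each group is the interval between two consecutive values.
\<close>
definition block_end :: "nat \<Rightarrow> nat \<Rightarrow> nat" where
  "block_end p t = (if t = 0 then 0 else group_end p t)"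

locale group_sizes =
  fixes p :: nat
  assumes p: "2 \<le> p"
begin

abbreviation "L \<equiv> ln (real p)"

lemma L_ge: "1 / 2 \<le> L" using ln_ge_half[OF p] .

text \<open>
  Since \<open>L\<close> is bounded away from \<open>0\<close>, every lower power of \<open>L\<close> can be charged to \<open>L ^ 4\<close>, also for small \<open>p\<close>.
\<close>
lemma powers_le_L4: "1 \<le> 16 * L ^ 4" "L \<le> 8 * L ^ 4" "L\<^sup>2 \<le> 4 * L ^ 4"
proof -
  have "1 \<le> (2 * L) ^ 2" "1 \<le> (2 * L) ^ 3" "1 \<le> (2 * L) ^ 4" 
    using L_ge by (intro one_le_power; simp)+
  then have a: "1 \<le> 4 * L ^ 2" "1 \<le> 8 * L ^ 3" "1 \<le> 16 * L ^ 4" by (simp_all add: power_mult_distrib)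
  show "1 \<le> 16 * L ^ 4" by fact
  show "L \<le> 8 * L ^ 4" using mult_left_mono[OF a(2), of L] L_ge by (simp add: eval_nat_numeral mult_ac)
  show "L\<^sup>2 \<le> 4 * L ^ 4" using mult_left_mono[OF a(1), of "L\<^sup>2"] by (simp add: eval_nat_numeral mult_ac)
qed

lemma rho_pos: "0 < group_rho p" and rho_le: "group_rho p \<le> 2"
  using L_ge by (auto simp: group_rho_def field_simps)

lemma group_first_bounds: "1 \<le> group_first p" "real (group_first p) \<le> L + 1"
  using L_ge by (auto simp: group_first_def) linarith+

lemma group_partial_1: "group_partial p 1 = group_first p"
  by (simp add: group_partial_def)

lemma group_partial_Suc:
  "1 \<le> t \<Longrightarrow> group_partial p (Suc t) = group_partial p t + nat \<lfloor>real (group_first p) * (1 + group_rho p) ^ t\<rfloor>"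
  by (simp add: group_partial_def)

lemma increment_bounds:
  defines "x \<equiv> \<lambda>t. real (group_first p) * (1 + group_rho p) ^ t"
  shows "1 \<le> nat \<lfloor>x t\<rfloor>" "x t - 1 \<le> real (nat \<lfloor>x t\<rfloor>)" "real (nat \<lfloor>x t\<rfloor>) \<le> x t"
proof -
  have "1 \<le> (1 + group_rho p) ^ t" using rho_pos by (intro one_le_power) auto
  then have "1 * 1 \<le> x t" unfolding x_def using group_first_bounds by (intro mult_mono) auto
  then show "1 \<le> nat \<lfloor>x t\<rfloor>" "x t - 1 \<le> real (nat \<lfloor>x t\<rfloor>)" "real (nat \<lfloor>x t\<rfloor>) \<le> x t"
    by linarith+
qed

lemma group_partial_ge: "1 \<le> t \<Longrightarrow> t \<le> group_partial p t"
proof (induction t rule: dec_induct)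
  case base
  then show ?case using group_first_bounds by (simp add: group_partial_def)
next
  case (step t)
  then show ?case using increment_bounds(1)[of t] by (simp add: group_partial_Suc)
qed

lemma group_count_exists: "1 \<le> p \<and> p \<le> group_partial p p"
  using p group_partial_ge[of p] by auto

lemma group_count: "1 \<le> group_count p" "p \<le> group_partial p (group_count p)"
  using LeastI[of "\<lambda>m. 1 \<le> m \<and> p \<le> group_partial p m", OF group_count_exists]
  by (auto simp: group_count_def)

lemma group_partial_less: "1 \<le> t \<Longrightarrow> t < group_count p \<Longrightarrow> group_partial p t < p"
  using not_less_Least[of t "\<lambda>m. 1 \<le> m \<and> p \<le> group_partial p m"] by (auto simp: group_count_def)

text \<open>
  The geometric series, with a loss of at most one for each floor; these losses add up to the last summand.
\<close>
lemma geometric_le_group_partial: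
  "1 \<le> t \<Longrightarrow> real (group_first p) * (1 + group_rho p) ^ t
    \<le> group_rho p * real (group_partial p t) + real (group_first p) + group_rho p * (real t - 1)"
proof (induction t rule: dec_induct)
  case base
  then show ?case by (simp add: group_partial_1[simplified] algebra_simps)
next
  case (step t)
  define x where "x = real (group_first p) * (1 + group_rho p) ^ t"
  have "real (group_first p) * (1 + group_rho p) ^ Suc t = x + group_rho p * x"
    by (simp add: x_def algebra_simps)
  also have "\<dots> \<le> x + group_rho p * (real (nat \<lfloor>x\<rfloor>) + 1)"
    using increment_bounds(2)[of t] rho_pos by (intro add_left_mono mult_left_mono) (auto simp: x_def)
  finally show ?case using step.IH step.hyps by (simp add: group_partial_Suc x_def algebra_simps)
qed

text \<open>
  If there are \<open>t + 2\<close> groups, the last but one has at least \<open>(1 + \<rho>)\<^sup>t - 1\<close> elements and ends before \<open>p\<close>,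
  so \<open>t ln (1 + \<rho>) \<le> L\<close>, where \<open>ln (1 + \<rho>) \<ge> 1 / (L + 1)\<close>.
\<close>
lemma group_count_le: "real (group_count p) \<le> 44 * L ^ 4"
proof -
  have "real (group_count p) \<le> 2 + L * (L + 1)"
  proof (cases "group_count p \<le> 2")
    case True
    then have "real (group_count p) \<le> 2 + 0" by simp
    also have "\<dots> \<le> 2 + L * (L + 1)" using L_ge by (intro add_left_mono mult_nonneg_nonneg) auto
    finally show ?thesis .
  next
    case False
    then obtain t where t: "group_count p = Suc (Suc t)" "1 \<le> t" by (metis numeral_2_eq_2 less_iff_Suc_add One_nat_def add_Suc not_le le_add1)
    have "1 * (1 + group_rho p) ^ t \<le> real (group_first p) * (1 + group_rho p) ^ t"
      using group_first_bounds rho_pos by (intro mult_right_mono) auto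
    also have "\<dots> \<le> real (nat \<lfloor>real (group_first p) * (1 + group_rho p) ^ t\<rfloor>) + 1"
      using increment_bounds(2)[of t] by simp
    also have "\<dots> \<le> real (group_partial p (Suc t))"
      using group_partial_ge[OF t(2)] t(2) by (simp add: group_partial_Suc)
    also have "\<dots> \<le> real p" using group_partial_less[of "Suc t"] t by simp
    finally have "ln ((1 + group_rho p) ^ t) \<le> L" using rho_pos p by (subst ln_le_cancel_iff) auto
    then have "real t * ln (1 + group_rho p) \<le> L" using rho_pos by (simp add: ln_realpow)
    moreover have "1 / (L + 1) \<le> ln (1 + group_rho p)"
    proof -
      have "ln (1 / (1 + group_rho p)) \<le> 1 / (1 + group_rho p) - 1" using rho_pos by (intro ln_le_minus_one) auto
      then have "1 - 1 / (1 + group_rho p) \<le> ln (1 + group_rho p)" using rho_pos by (simp add: ln_div)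
      moreover have "1 - 1 / (1 + group_rho p) = 1 / (L + 1)" using L_ge by (simp add: group_rho_def field_simps)
      ultimately show ?thesis by simp
    qed
    ultimately have "real t * (1 / (L + 1)) \<le> L"
      by (meson mult_left_mono of_nat_0_le_iff order_trans)
    then have "real t \<le> L * (L + 1)" using L_ge by (simp add: field_simps)
    then show ?thesis using t by simp
  qed
  also have "\<dots> = 2 + L\<^sup>2 + L" by (simp add: power2_eq_square algebra_simps)
  also have "\<dots> \<le> 44 * L ^ 4" using powers_le_L4 by linarith
  finally show ?thesis .
qed

lemma block_end_0: "block_end p 0 = 0"
  by (simp add: block_end_def)

lemma block_end_count: "block_end p (group_count p) = p"
  using group_count by (auto simp: block_end_def group_end_def)

lemma block_end_mono: "t < group_count p \<Longrightarrow> block_end p t \<le> block_end p (Suc t)"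
  using group_partial_less[of t] group_partial_Suc[of t]
  by (cases "t = 0") (auto simp: block_end_def group_end_def)

lemma block_end_le_partial: "1 \<le> t \<Longrightarrow> t \<le> group_count p \<Longrightarrow> block_end p t \<le> group_partial p t"
  using group_count by (cases "t = group_count p") (auto simp: block_end_def group_end_def)

text \<open>
  A new group is \<open>\<rho>\<close> times everything before it, up to the size of the first group and the accumulated
  floor losses, at most \<open>\<rho>\<close> for each group; both are \<open>O(L ^ 4)\<close>.
\<close>
lemma block_end_step:
  assumes "t < group_count p"
  shows "real (block_end p (Suc t)) \<le> (1 + group_rho p) * real (block_end p t) + 112 * L ^ 4"
proof (cases "t = 0")
  case True
  then have "real (block_end p (Suc t)) \<le> real (group_first p)"
    using block_end_le_partial[of 1] assms group_partial_1 by simp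
  also have "\<dots> \<le> 112 * L ^ 4" using group_first_bounds powers_le_L4 by linarith
  finally show ?thesis using True by (simp add: block_end_0)
next
  case False
  then have t: "1 \<le> t" by simp
  have "real (block_end p (Suc t)) \<le> real (group_partial p (Suc t))"
    using block_end_le_partial[of "Suc t"] assms by simp
  also have "\<dots> \<le> real (group_partial p t) + real (group_first p) * (1 + group_rho p) ^ t"
    using increment_bounds(3)[of t] t by (simp add: group_partial_Suc)
  also have "\<dots> \<le> (1 + group_rho p) * real (group_partial p t) + real (group_first p) + group_rho p * (real t - 1)"
    using geometric_le_group_partial[OF t] by (simp add: algebra_simps)
  also have "group_rho p * (real t - 1) \<le> 2 * real (group_count p)"
    using rho_le rho_pos t assms by (intro mult_mono) auto
  finally show ?thesis
    using group_first_bounds powers_le_L4 group_count_le t assms by (simp add: block_end_def group_end_def)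
qed

lemma group_nested_eq: "group_nested p = (\<lambda>t. {1..block_end p t}) ` {1..group_count p}"
  by (auto simp: group_nested_def block_end_def)

end

section \<open>Nested models: shrinkage factors and rounding up\<close>

lemma shrinkage_nonneg:
  "w \<in> weights \<M> \<Longrightarrow> 0 \<le> shrinkage \<M> w j"
  by (auto simp: shrinkage_def weights_def intro!: sum_nonneg)

lemma shrinkage_le_1:
  assumes "finite \<M>" "w \<in> weights \<M>"
  shows "shrinkage \<M> w j \<le> 1"
proof -
  have "shrinkage \<M> w j \<le> (\<Sum>I\<in>\<M>. w I)"
    unfolding shrinkage_def using assms by (intro sum_mono2) (auto simp: weights_def)
  then show ?thesis using assms by (simp add: weights_def)
qed

lemma shrinkage_mix:
  "shrinkage \<M> (\<lambda>I. w I + \<tau> * (v I - w I)) j = shrinkage \<M> w j + \<tau> * (shrinkage \<M> v j - shrinkage \<M> w j)"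
  by (simp add: shrinkage_def sum.distrib sum_distrib_left sum_subtractf right_diff_distrib)

lemma weights_mix:
  assumes "finite \<M>" "w \<in> weights \<M>" "v \<in> weights \<M>" "0 \<le> \<tau>" "\<tau> \<le> 1"
  shows "(\<lambda>I. w I + \<tau> * (v I - w I)) \<in> weights \<M>"
proof -
  have s: "(\<Sum>I\<in>\<M>. w I + \<tau> * (v I - w I)) = 1"
    using assms by (simp add: weights_def sum.distrib sum_distrib_left[symmetric] sum_subtractf)
  have "0 \<le> w I + \<tau> * (v I - w I) \<and> w I + \<tau> * (v I - w I) \<le> 1" if "I \<in> \<M>" for I
  proof -
    have "0 \<le> w I" "0 \<le> v I" "w I \<le> 1" "v I \<le> 1" using assms that by (auto simp: weights_def)
    then have "0 \<le> (1 - \<tau>) * w I" "0 \<le> \<tau> * v I" "(1 - \<tau>) * w I \<le> 1 - \<tau>" "\<tau> * v I \<le> \<tau>"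
      using assms by (auto intro!: mult_nonneg_nonneg mult_left_le)
    then show ?thesis by (simp add: algebra_simps)
  qed
  with s show ?thesis by (simp add: weights_def)
qed

text \<open>
  At a minimiser the derivative along the segment to \<open>y\<close> is nonnegative, so going to \<open>y\<close> raises \<open>F\<close> by at least
  its second-order part.
\<close>
lemma quadratic_min_strongly_convex:
  fixes a b x y :: "'i \<Rightarrow> real" and A :: "'i set"
  defines "F \<equiv> \<lambda>z. \<Sum>i\<in>A. (z i)\<^sup>2 * a i - 2 * z i * b i"
  assumes a: "\<And>i. i \<in> A \<Longrightarrow> 0 \<le> a i"
    and min: "\<And>\<tau>. 0 \<le> \<tau> \<Longrightarrow> \<tau> \<le> 1 \<Longrightarrow> F x \<le> F (\<lambda>i. x i + \<tau> * (y i - x i))"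
  shows "F x + (\<Sum>i\<in>A. a i * (y i - x i)\<^sup>2) \<le> F y"
proof -
  define G where "G = (\<Sum>i\<in>A. (x i * a i - b i) * (y i - x i))"
  define H where "H = (\<Sum>i\<in>A. a i * (y i - x i)\<^sup>2)"
  have expand: "F (\<lambda>i. x i + \<tau> * (y i - x i)) = F x + 2 * \<tau> * G + \<tau>\<^sup>2 * H" for \<tau>
    unfolding F_def G_def H_def sum_distrib_left sum.distrib[symmetric]
    by (intro sum.cong refl) (simp add: power2_eq_square algebra_simps)
  have H: "0 \<le> H" unfolding H_def using a by (intro sum_nonneg mult_nonneg_nonneg) auto
  have "0 \<le> G"
  proof (rule ccontr)
    assume "\<not> 0 \<le> G"
    then have G: "G < 0" by simp
    \<comment> \<open>a step so short that the curvature cannot make up for the negative slope\<close>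
    define \<tau> where "\<tau> = min 1 (- G / (H + 1))"
    have "\<tau> \<le> - G / (H + 1)" by (simp add: \<tau>_def)
    moreover have "0 < - G / (H + 1)" using G H by (intro divide_pos_pos) auto
    ultimately have \<tau>: "0 < \<tau>" "\<tau> \<le> 1" "\<tau> * (H + 1) \<le> - G"
      using H by (auto simp: \<tau>_def pos_le_divide_eq[symmetric])
    have "0 \<le> \<tau> * (2 * G + \<tau> * H)"
      using min[of \<tau>] \<tau> expand[of \<tau>] by (simp add: power2_eq_square algebra_simps)
    then have "0 \<le> 2 * G + \<tau> * H" using \<tau> by (simp add: zero_le_mult_iff)
    then show False using \<tau> G by (simp add: algebra_simps)
  qed
  moreover have "F y = F x + 2 * G + H" using expand[of 1] by simp
  ultimately show ?thesis by (simp add: H_def)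
qed

text \<open>
  In the application \<open>A\<close> is the expected curvature on a block, \<open>l\<close> and \<open>q\<close> are the linear and the quadratic part of
  the noise, and \<open>u\<close> is the error of the variance estimator.  The random part \<open>2 * l + q\<close> of the curvature is treated
  like the linear term, because \<open>d\<^sup>2 \<le> \<bar>d\<bar>\<close>; then the square is completed with \<open>(A + \<tau>) * d\<^sup>2\<close>.  The summand \<open>\<tau>\<close>
  keeps the denominator positive on a block with \<open>A = 0\<close>.
\<close>
lemma block_excess_bound:
  fixes A l q u d \<tau> :: real
  assumes "0 \<le> A" "0 < \<tau>" "\<bar>d\<bar> \<le> 1"
  shows "2 * d * (l + q - u) - (A + 2 * l + q) * d\<^sup>2 \<le> (12 * l\<^sup>2 + 7 * q\<^sup>2 + 3 * u\<^sup>2) / (A + \<tau>) + \<tau>"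
proof -
  define X where "X = 2 * \<bar>l\<bar> + 3 / 2 * \<bar>q\<bar> + \<bar>u\<bar>"
  have d2: "d\<^sup>2 \<le> \<bar>d\<bar>" "d\<^sup>2 \<le> 1"
    using assms(3) mult_left_mono[of "\<bar>d\<bar>" 1 "\<bar>d\<bar>"] by (auto simp: power2_eq_square abs_square_le_1[unfolded power2_eq_square])
  have "2 * d * (l + q - u) - (2 * l + q) * d\<^sup>2 \<le> 2 * \<bar>d\<bar> * X"
  proof -
    have "2 * d * (l + q - u) \<le> 2 * (\<bar>d\<bar> * \<bar>l + q - u\<bar>)"
      by (simp add: abs_mult[symmetric])
    also have "\<dots> \<le> 2 * (\<bar>d\<bar> * (\<bar>l\<bar> + \<bar>q\<bar> + \<bar>u\<bar>))" by (intro mult_left_mono) auto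
    finally have 1: "2 * d * (l + q - u) \<le> 2 * (\<bar>d\<bar> * (\<bar>l\<bar> + \<bar>q\<bar> + \<bar>u\<bar>))" .
    have "- (2 * l + q) * d\<^sup>2 \<le> \<bar>2 * l + q\<bar> * d\<^sup>2" by (rule mult_right_mono) auto
    also have "\<dots> \<le> (2 * \<bar>l\<bar> + \<bar>q\<bar>) * \<bar>d\<bar>" using d2 by (intro mult_mono) auto
    finally show ?thesis using 1 by (simp add: X_def algebra_simps)
  qed
  moreover have "2 * \<bar>d\<bar> * X \<le> X\<^sup>2 / (A + \<tau>) + (A + \<tau>) * d\<^sup>2"
  proof -
    have pos: "0 < A + \<tau>" using assms by simp
    define B where "B = A + \<tau>"
    have "0 \<le> (X - B * \<bar>d\<bar>)\<^sup>2 / B" using pos by (simp add: B_def)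
    also have "(X - B * \<bar>d\<bar>)\<^sup>2 = X\<^sup>2 + B\<^sup>2 * d\<^sup>2 - 2 * X * (B * \<bar>d\<bar>)"
      by (simp add: power2_diff power_mult_distrib)
    also have "\<dots> / B = X\<^sup>2 / B + B * d\<^sup>2 - 2 * \<bar>d\<bar> * X"
      using pos unfolding B_def[symmetric] by (simp add: field_simps power2_eq_square)
    finally show ?thesis by (simp add: B_def)
  qed
  moreover have "X\<^sup>2 / (A + \<tau>) \<le> (12 * l\<^sup>2 + 7 * q\<^sup>2 + 3 * u\<^sup>2) / (A + \<tau>)"
  proof (intro divide_right_mono)
    have three: "(a + b + c)\<^sup>2 \<le> 3 * (a\<^sup>2 + b\<^sup>2 + c\<^sup>2)" for a b c :: real
      using zero_le_power2[of "a - b"] zero_le_power2[of "b - c"] zero_le_power2[of "a - c"]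
      by (simp add: power2_eq_square algebra_simps)
    have "X\<^sup>2 \<le> 3 * ((2 * \<bar>l\<bar>)\<^sup>2 + (3 / 2 * \<bar>q\<bar>)\<^sup>2 + \<bar>u\<bar>\<^sup>2)" unfolding X_def by (rule three)
    also have "\<dots> \<le> 12 * l\<^sup>2 + 7 * q\<^sup>2 + 3 * u\<^sup>2" by (simp add: power_mult_distrib power_divide)
    finally show "X\<^sup>2 \<le> 12 * l\<^sup>2 + 7 * q\<^sup>2 + 3 * u\<^sup>2" .
  qed (use assms in simp)
  moreover have "\<tau> * d\<^sup>2 \<le> \<tau>" using assms d2 by (simp add: mult_left_le)
  ultimately show ?thesis by (simp add: algebra_simps)
qed

locale nested_blocks =
  fixes J :: "nat \<Rightarrow> nat" and m p :: nat
  assumes J_0: "J 0 = 0" and J_Suc: "\<And>t. t < m \<Longrightarrow> J t \<le> J (Suc t)" and J_m: "J m = p"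
begin

definition models :: "nat set set" where
  "models = (\<lambda>t. {1..J t}) ` {1..m}"

lemma J_mono: "s \<le> t \<Longrightarrow> t \<le> m \<Longrightarrow> J s \<le> J t"
proof (induction t rule: dec_induct)
  case (step t)
  then show ?case using J_Suc[of t] by simp
qed simp

lemma finite_models: "finite models"
  by (simp add: models_def)

lemma models_subset: "models \<subseteq> Pow {1..p}"
  using J_mono[of _ m] by (force simp: models_def J_m)

text \<open>
  A nested model that contains one coordinate of a block contains the whole block.
\<close>
lemma shrinkage_block:
  assumes "t < m" "j \<in> {J t<..J (Suc t)}"
  shows "shrinkage models w j = shrinkage models w (J (Suc t))"
proof -
  have "j \<le> J s \<longleftrightarrow> J (Suc t) \<le> J s" if "s \<le> m" for s
    using J_mono[of s t] J_mono[of "Suc t" s] assms that by (cases "s \<le> t") auto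
  then have "{I \<in> models. j \<in> I} = {I \<in> models. J (Suc t) \<in> I}"
    unfolding models_def using assms(2) by (intro Collect_cong) (auto dest: less_le_trans)
  then show ?thesis by (simp add: shrinkage_def)
qed

lemma sum_coordinates: "(\<Sum>j=1..p. f j :: real) = (\<Sum>t<m. \<Sum>j\<in>{J t<..J (Suc t)}. f j)"
  using sum_blocks[of J m f, OF J_0 J_Suc] by (simp add: J_m)

lemma sum_block_sizes: "(\<Sum>t<m. real (J (Suc t)) - real (J t)) = real p"
  using sum_lessThan_telescope[of "\<lambda>t. real (J t)" m] by (simp add: J_m J_0)

end

lemma sum_all_nested: "(\<Sum>I\<in>{I\<in>all_nested p. P I}. w I) = (\<Sum>j\<in>{j\<in>{1..p}. P {1..j}}. w {1..j})"
proof -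
  have "inj_on (\<lambda>m. {1..m}) {j\<in>{1..p}. P {1..j}}"
  proof (rule inj_onI)
    fix a b :: nat assume "{1..a} = {1..b}"
    from arg_cong[OF this, of card] show "a = b" by simp
  qed
  moreover have "{I\<in>all_nested p. P I} = (\<lambda>m. {1..m}) ` {j\<in>{1..p}. P {1..j}}"
    by (auto simp: all_nested_def)
  ultimately show ?thesis by (simp add: sum.reindex)
qed

lemma shrinkage_all_nested:
  assumes "1 \<le> i"
  shows "shrinkage (all_nested p) w i = (\<Sum>j\<in>{j\<in>{1..p}. i \<le> j}. w {1..j})"
proof -
  have "{j\<in>{1..p}. i \<in> {1..j}} = {j\<in>{1..p}. i \<le> j}" using assms by auto
  then show ?thesis unfolding shrinkage_def sum_all_nested by (simp only:)
qed

lemma shrinkage_all_nested_antimono: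
  assumes "1 \<le> i" "i \<le> j" "w \<in> weights (all_nested p)"
  shows "shrinkage (all_nested p) w j \<le> shrinkage (all_nested p) w i"
proof -
  have "0 \<le> w {1..k}" if "k \<in> {1..p}" for k using assms(3) that by (auto simp: weights_def all_nested_def)
  then have "(\<Sum>k\<in>{k\<in>{1..p}. j \<le> k}. w {1..k}) \<le> (\<Sum>k\<in>{k\<in>{1..p}. i \<le> k}. w {1..k})"
    using assms by (intro sum_mono2) auto
  moreover have "1 \<le> j" using assms by simp
  ultimately show ?thesis using assms by (simp only: shrinkage_all_nested)
qed

context nested_blocks begin

definition enclosing :: "nat \<Rightarrow> nat set" where
  "enclosing j = {1..J (LEAST t. j \<le> J t)}"

text \<open>
  The weights on the models \<open>{1..J t}\<close> that arise when the weight of each \<open>{1..j}\<close> moves to the smallest of these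
  models that contains it.
\<close>
definition round_up :: "(nat set \<Rightarrow> real) \<Rightarrow> nat set \<Rightarrow> real" where
  "round_up w I = (\<Sum>j\<in>{j\<in>{1..p}. enclosing j = I}. w {1..j})"

lemma enclosing_index:
  assumes "j \<in> {1..p}"
  shows "j \<le> J (LEAST t. j \<le> J t)" "(LEAST t. j \<le> J t) \<in> {1..m}"
proof -
  have jm: "j \<le> J m" using assms J_m by auto
  show *: "j \<le> J (LEAST t. j \<le> J t)" by (rule LeastI, rule jm)
  have "(LEAST t. j \<le> J t) \<le> m" by (rule Least_le, rule jm)
  moreover have "(LEAST t. j \<le> J t) \<noteq> 0"
  proof
    assume "(LEAST t. j \<le> J t) = 0"
    with * assms J_0 show False by auto
  qed
  ultimately show "(LEAST t. j \<le> J t) \<in> {1..m}" by simp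
qed

lemma enclosing_models: "j \<in> {1..p} \<Longrightarrow> enclosing j \<in> models"
  using enclosing_index(2)[of j] by (auto simp: enclosing_def models_def)

lemma mem_enclosing_iff:
  assumes t: "t < m" and i: "i \<in> {J t<..J (Suc t)}" and j: "j \<in> {1..p}"
  shows "i \<in> enclosing j \<longleftrightarrow> Suc (J t) \<le> j"
proof
  let ?s = "LEAST t. j \<le> J t"
  assume "i \<in> enclosing j"
  then have "i \<le> J ?s" by (simp add: enclosing_def)
  then have "\<not> ?s \<le> t" using J_mono[of ?s t] t i by auto
  then show "Suc (J t) \<le> j" using Least_le[of "\<lambda>t. j \<le> J t" t] by (metis not_less_eq_eq)
next
  let ?s = "LEAST t. j \<le> J t"
  assume "Suc (J t) \<le> j"
  then have "\<not> ?s \<le> t" using J_mono[of ?s t] enclosing_index(1)[OF j] t by auto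
  then have "J (Suc t) \<le> J ?s" using enclosing_index(2)[OF j] by (intro J_mono) auto
  then show "i \<in> enclosing j" using i by (auto simp: enclosing_def)
qed

text \<open>
  A model \<open>{1..j}\<close> that reaches the block at all is rounded up to a model that contains the whole block.  So the factor
  on the block is the old factor at its first coordinate, the largest one on the block.
\<close>
lemma shrinkage_round_up:
  assumes t: "t < m" and i: "i \<in> {J t<..J (Suc t)}"
  shows "shrinkage models (round_up w) i = shrinkage (all_nested p) w (Suc (J t))"
proof -
  let ?S = "{j\<in>{1..p}. i \<in> enclosing j}"
  have "shrinkage models (round_up w) i = (\<Sum>I\<in>{I\<in>models. i \<in> I}. \<Sum>j\<in>{j\<in>?S. enclosing j = I}. w {1..j})"
    unfolding shrinkage_def round_up_def by (intro sum.cong refl) auto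
  also have "\<dots> = (\<Sum>j\<in>?S. w {1..j})"
    using finite_models enclosing_models by (intro sum.group) auto
  also have "?S = {j\<in>{1..p}. Suc (J t) \<le> j}"
    using mem_enclosing_iff[OF t i] by blast
  also have "(\<Sum>j\<in>\<dots>. w {1..j}) = shrinkage (all_nested p) w (Suc (J t))"
    by (rule shrinkage_all_nested[symmetric]) simp
  finally show ?thesis .
qed

lemma round_up_weights:
  assumes w: "w \<in> weights (all_nested p)"
  shows "round_up w \<in> weights models"
proof -
  have nonneg: "0 \<le> w {1..j}" if "j \<in> {1..p}" for j
    using w that by (auto simp: weights_def all_nested_def)
  have nn: "0 \<le> round_up w I" for I
    unfolding round_up_def using nonneg by (intro sum_nonneg) auto
  have "(\<Sum>I\<in>models. round_up w I) = (\<Sum>j\<in>{1..p}. w {1..j})"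
    unfolding round_up_def using finite_models enclosing_models by (intro sum.group) auto
  also have "\<dots> = (\<Sum>I\<in>all_nested p. w I)" using sum_all_nested[of w p "\<lambda>_. True"] by (simp del: atLeastAtMost_iff)
  finally have one: "(\<Sum>I\<in>models. round_up w I) = 1" using w by (simp add: weights_def)
  then have "round_up w I \<le> 1" if "I \<in> models" for I
    using member_le_sum[OF that, of "round_up w"] finite_models nn by simp
  with nn one show ?thesis by (simp add: weights_def)
qed

text \<open>
  On a block the new squared factor \<open>h t\<close> is the old one at the first coordinate.  After the shift by one block,
  \<open>h (Suc t)\<close> is at most every old squared factor on the block \<open>t\<close>, because the old factors decrease.
\<close>
lemma variance_round_up:
  assumes w: "w \<in> weights (all_nested p)" and "1 \<le> m" "0 \<le> \<rho>" "0 \<le> D"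
    and step: "\<And>t. t < m \<Longrightarrow> real (J (Suc t)) \<le> (1 + \<rho>) * real (J t) + D"
  shows "(\<Sum>j=1..p. (shrinkage models (round_up w) j)\<^sup>2) \<le> (1 + \<rho>) * (\<Sum>j=1..p. (shrinkage (all_nested p) w j)\<^sup>2) + D"
proof -
  let ?T = "shrinkage (all_nested p) w"
  define h where "h t = (?T (Suc (J t)))\<^sup>2" for t
  obtain k where k: "m = Suc k" using assms(2) by (cases m) auto
  have fin: "finite (all_nested p)" by (simp add: all_nested_def)
  have T: "0 \<le> ?T i" "?T i \<le> 1" for i
    using shrinkage_nonneg[OF w] shrinkage_le_1[OF fin w] by auto
  have size: "real (card {J t<..J (Suc t)}) = real (J (Suc t)) - real (J t)" if "t < m" for t
    using J_Suc[OF that] by (simp add: of_nat_diff)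
  have "(\<Sum>j=1..p. (shrinkage models (round_up w) j)\<^sup>2) = (\<Sum>t<m. \<Sum>j\<in>{J t<..J (Suc t)}. h t)"
    unfolding sum_coordinates h_def by (intro sum.cong refl) (simp add: shrinkage_round_up)
  also have "\<dots> = (\<Sum>t<Suc k. (real (J (Suc t)) - real (J t)) * h t)"
    using size by (simp add: k)
  also have "\<dots> \<le> (1 + \<rho>) * (\<Sum>t<k. (real (J (Suc t)) - real (J t)) * h (Suc t)) + D * h 0"
  proof (rule sum_block_shift_le)
    show "h (Suc t) \<le> h t" if "t < k" for t
      unfolding h_def using T J_Suc[of t] that k w
      by (intro power_mono shrinkage_all_nested_antimono) auto
  qed (use J_0 step k in \<open>auto simp: h_def\<close>)
  also have "(\<Sum>t<k. (real (J (Suc t)) - real (J t)) * h (Suc t)) \<le> (\<Sum>t<k. \<Sum>j\<in>{J t<..J (Suc t)}. (?T j)\<^sup>2)"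
  proof (rule sum_mono)
    fix t assume "t \<in> {..<k}"
    then have t: "t < m" using k by simp
    have "(real (J (Suc t)) - real (J t)) * h (Suc t) = (\<Sum>j\<in>{J t<..J (Suc t)}. h (Suc t))"
      using size[OF t] by simp
    also have "\<dots> \<le> (\<Sum>j\<in>{J t<..J (Suc t)}. (?T j)\<^sup>2)"
      unfolding h_def using T w by (intro sum_mono power_mono shrinkage_all_nested_antimono) auto
    finally show "(real (J (Suc t)) - real (J t)) * h (Suc t) \<le> (\<Sum>j\<in>{J t<..J (Suc t)}. (?T j)\<^sup>2)" .
  qed
  also have "\<dots> \<le> (\<Sum>t<m. \<Sum>j\<in>{J t<..J (Suc t)}. (?T j)\<^sup>2)"
    unfolding k by (intro sum_mono2 sum_nonneg) auto
  also have "\<dots> = (\<Sum>j=1..p. (?T j)\<^sup>2)" by (rule sum_coordinates[symmetric])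
  also have "D * h 0 \<le> D"
    using assms(4) T[of "Suc (J 0)"] by (auto simp: h_def intro!: mult_left_le power_le_one)
  finally show ?thesis using assms(3) by (simp add: mult_left_mono)
qed

text \<open>
  Rounding up brings every factor closer to one.
\<close>
lemma bias_round_up:
  assumes w: "w \<in> weights (all_nested p)"
  shows "(\<Sum>j=1..p. (1 - shrinkage models (round_up w) j)\<^sup>2 * (\<theta> j)\<^sup>2)
    \<le> (\<Sum>j=1..p. (1 - shrinkage (all_nested p) w j)\<^sup>2 * (\<theta> j)\<^sup>2)"
  unfolding sum_coordinates
proof (intro sum_mono mult_right_mono power_mono)
  fix t j assume "t \<in> {..<m}" and j: "j \<in> {J t<..J (Suc t)}"
  then have "shrinkage (all_nested p) w j \<le> shrinkage models (round_up w) j"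
    using w by (subst shrinkage_round_up[of t]) (auto intro!: shrinkage_all_nested_antimono)
  then show "1 - shrinkage models (round_up w) j \<le> 1 - shrinkage (all_nested p) w j" by simp
  show "0 \<le> 1 - shrinkage models (round_up w) j"
    using shrinkage_le_1[OF finite_models round_up_weights[OF w]] by simp
qed simp

end

section \<open>Linear and quadratic forms in independent noise\<close>

definition square_integrable :: "'a measure \<Rightarrow> ('a \<Rightarrow> real) \<Rightarrow> bool" where
  "square_integrable M f \<longleftrightarrow> f \<in> borel_measurable M \<and> integrable M (\<lambda>x. (f x)\<^sup>2)"

lemma square_integrable_mult:
  assumes "square_integrable M f" "square_integrable M g"
  shows "integrable M (\<lambda>x. f x * g x)"
proof (rule Bochner_Integration.integrable_bound)
  show "integrable M (\<lambda>x. (f x)\<^sup>2 + (g x)\<^sup>2)" using assms by (auto simp: square_integrable_def)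
  show "(\<lambda>x. f x * g x) \<in> borel_measurable M" using assms by (auto simp: square_integrable_def)
  have "\<bar>a * b\<bar> \<le> a\<^sup>2 + b\<^sup>2" for a b :: real
  proof -
    have "0 \<le> \<bar>a\<bar> * \<bar>b\<bar>" by simp
    moreover have "2 * (\<bar>a\<bar> * \<bar>b\<bar>) \<le> a\<^sup>2 + b\<^sup>2" using sum_squares_bound[of "\<bar>a\<bar>" "\<bar>b\<bar>"] by simp
    ultimately show ?thesis unfolding abs_mult by linarith
  qed
  then show "AE x in M. norm (f x * g x) \<le> norm ((f x)\<^sup>2 + (g x)\<^sup>2)"
    by simp
qed

lemma square_integrable_add:
  assumes f: "square_integrable M f" and g: "square_integrable M g"
  shows "square_integrable M (\<lambda>x. f x + g x)"
proof -
  have "integrable M (\<lambda>x. (f x)\<^sup>2 + (g x)\<^sup>2 + 2 * (f x * g x))"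
    using square_integrable_mult[OF assms] assms by (auto simp: square_integrable_def)
  then have "integrable M (\<lambda>x. (f x + g x)\<^sup>2)"
    by (simp add: power2_sum mult_ac)
  then show ?thesis using assms by (auto simp: square_integrable_def)
qed

lemma square_integrable_cmult:
  "square_integrable M f \<Longrightarrow> square_integrable M (\<lambda>x. c * f x)"
  by (auto simp: square_integrable_def power_mult_distrib)

lemma square_integrable_sum:
  "(\<And>i. i \<in> A \<Longrightarrow> square_integrable M (f i)) \<Longrightarrow> square_integrable M (\<lambda>x. \<Sum>i\<in>A. f i x)"
proof (induction A rule: infinite_finite_induct)
  case (insert x F)
  then show ?case using square_integrable_add[of M "f x" "\<lambda>y. \<Sum>i\<in>F. f i y"] by simp
qed (auto simp: square_integrable_def)

context prob_space begin

lemma square_integrable_const: "square_integrable M (\<lambda>_. c)"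
  by (auto simp: square_integrable_def)

lemma square_integrable_integrable: "square_integrable M f \<Longrightarrow> integrable M f"
  using square_integrable_mult[OF _ square_integrable_const[of 1]] by simp

end

lemma sum_symmetric:
  fixes f :: "nat \<Rightarrow> nat \<Rightarrow> real"
  assumes "\<And>i k. f i k = f k i"
  shows "(\<Sum>i<N. \<Sum>k<N. f i k) = (\<Sum>k<N. f k k + 2 * (\<Sum>i<k. f i k))"
proof (induction N)
  case (Suc N)
  have "(\<Sum>i<N. f N i) = (\<Sum>i<N. f i N)" using assms by simp
  then show ?case using Suc by (simp add: sum.distrib algebra_simps)
qed simp

text \<open>
  The bound on the fourth moments is relative to \<open>\<sigma> ^ 4\<close>.  In this form every moment bound below carries a power
  of \<open>\<sigma>\<close> that the expected curvature of a block can absorb, also for small \<open>\<sigma>\<close>.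
\<close>
locale centred_noise = prob_space M for M :: "'a measure" +
  fixes n :: nat and \<epsilon> :: "nat \<Rightarrow> 'a \<Rightarrow> real" and \<sigma> \<kappa> :: real
  assumes indep: "indep_vars (\<lambda>_. borel) \<epsilon> {..<n}"
    and integrable4: "\<And>i. i < n \<Longrightarrow> integrable M (\<lambda>\<omega>. \<epsilon> i \<omega> ^ 4)"
    and mean: "\<And>i. i < n \<Longrightarrow> expectation (\<epsilon> i) = 0"
    and second_moment: "\<And>i. i < n \<Longrightarrow> expectation (\<lambda>\<omega>. (\<epsilon> i \<omega>)\<^sup>2) = \<sigma>\<^sup>2"
    and fourth_moment: "\<And>i. i < n \<Longrightarrow> expectation (\<lambda>\<omega>. \<epsilon> i \<omega> ^ 4) \<le> \<kappa> * \<sigma> ^ 4"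
    and kappa_nonneg: "0 \<le> \<kappa>"
begin

lemma measurable_noise [measurable]: "i < n \<Longrightarrow> \<epsilon> i \<in> borel_measurable M"
  using indep by (auto simp: indep_vars_def)

lemma square_integrable_noise_sq: "i < n \<Longrightarrow> square_integrable M (\<lambda>\<omega>. (\<epsilon> i \<omega>)\<^sup>2)"
  using integrable4[of i] by (auto simp: square_integrable_def)

lemma square_integrable_noise: "i < n \<Longrightarrow> square_integrable M (\<epsilon> i)"
  using square_integrable_integrable[OF square_integrable_noise_sq[of i]] by (auto simp: square_integrable_def)

text \<open>
  The first \<open>k\<close> noise variables as a point of the product space, so that functions of them are independent of \<open>\<epsilon> k\<close>.
\<close>
definition past :: "nat \<Rightarrow> 'a \<Rightarrow> nat \<Rightarrow> real" where
  "past k \<omega> = restrict (\<lambda>i. \<epsilon> i \<omega>) {..<k}"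

lemma indep_past:
  assumes k: "k < n" and F: "F \<in> borel_measurable (PiM {..<k} (\<lambda>_. borel))" and G: "G \<in> borel_measurable borel"
    and int: "integrable M (\<lambda>\<omega>. F (past k \<omega>) :: real)" "integrable M (\<lambda>\<omega>. G (\<epsilon> k \<omega>) :: real)"
  shows "integrable M (\<lambda>\<omega>. F (past k \<omega>) * G (\<epsilon> k \<omega>))"
    and "expectation (\<lambda>\<omega>. F (past k \<omega>) * G (\<epsilon> k \<omega>)) = expectation (\<lambda>\<omega>. F (past k \<omega>)) * expectation (\<lambda>\<omega>. G (\<epsilon> k \<omega>))"
proof -
  have G': "(\<lambda>f. G (f k)) \<in> borel_measurable (PiM {k} (\<lambda>_. borel))"
    using G by measurable
  have "indep_var (PiM {..<k} (\<lambda>_. borel)) (\<lambda>\<omega>. restrict (\<lambda>i. \<epsilon> i \<omega>) {..<k})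
      (PiM {k} (\<lambda>_. borel)) (\<lambda>\<omega>. restrict (\<lambda>i. \<epsilon> i \<omega>) {k})"
    using k by (intro indep_var_restrict[OF indep]) auto
  from indep_var_compose[OF this F G']
  have "indep_var borel (\<lambda>\<omega>. F (past k \<omega>)) borel (\<lambda>\<omega>. G (\<epsilon> k \<omega>))"
    by (simp add: comp_def past_def)
  from indep_var_integrable[OF this int] indep_var_lebesgue_integral[OF this int]
  show "integrable M (\<lambda>\<omega>. F (past k \<omega>) * G (\<epsilon> k \<omega>))"
    and "expectation (\<lambda>\<omega>. F (past k \<omega>) * G (\<epsilon> k \<omega>)) = expectation (\<lambda>\<omega>. F (past k \<omega>)) * expectation (\<lambda>\<omega>. G (\<epsilon> k \<omega>))"
    by simp_all
qed

definition lin :: "(nat \<Rightarrow> real) \<Rightarrow> nat \<Rightarrow> (nat \<Rightarrow> real) \<Rightarrow> real" where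
  "lin a N x = (\<Sum>i<N. a i * x i)"

lemma lin_past: "lin a N (past N \<omega>) = lin a N (\<lambda>i. \<epsilon> i \<omega>)"
  by (simp add: lin_def past_def)

lemma measurable_lin: "lin a N \<in> borel_measurable (PiM {..<N} (\<lambda>_. borel))"
proof -
  have "(\<lambda>x. a i * x i) \<in> borel_measurable (PiM {..<N} (\<lambda>_. borel))" if "i \<in> {..<N}" for i
    using measurable_component_singleton[OF that, of "\<lambda>_. borel"] by measurable
  then show ?thesis unfolding lin_def[abs_def] by (rule borel_measurable_sum)
qed

lemma square_integrable_lin: "N \<le> n \<Longrightarrow> square_integrable M (\<lambda>\<omega>. lin a N (\<lambda>i. \<epsilon> i \<omega>))"
  unfolding lin_def by (intro square_integrable_sum square_integrable_cmult square_integrable_noise) auto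

lemma lin_mean: "N \<le> n \<Longrightarrow> expectation (\<lambda>\<omega>. lin a N (\<lambda>i. \<epsilon> i \<omega>)) = 0"
  unfolding lin_def
  by (subst Bochner_Integration.integral_sum) (auto simp: mean intro!: square_integrable_integrable square_integrable_noise)

lemma lin_second_moment:
  "N \<le> n \<Longrightarrow> expectation (\<lambda>\<omega>. (lin a N (\<lambda>i. \<epsilon> i \<omega>))\<^sup>2) = \<sigma>\<^sup>2 * (\<Sum>i<N. (a i)\<^sup>2)"
proof (induction N)
  case (Suc N)
  then have N: "N < n" "N \<le> n" by auto
  define X where "X \<omega> = lin a N (\<lambda>i. \<epsilon> i \<omega>)" for \<omega>
  have X: "square_integrable M X" unfolding X_def using N by (intro square_integrable_lin)
  have iX2: "integrable M (\<lambda>\<omega>. (X \<omega>)\<^sup>2)" using X by (simp add: square_integrable_def)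
  have ie2: "integrable M (\<lambda>\<omega>. (\<epsilon> N \<omega>)\<^sup>2)" using square_integrable_noise N by (simp add: square_integrable_def)
  have ie: "integrable M (\<epsilon> N)" "integrable M X"
    using N X square_integrable_noise by (auto intro: square_integrable_integrable)
  have cross: "integrable M (\<lambda>\<omega>. X \<omega> * \<epsilon> N \<omega>)" "expectation (\<lambda>\<omega>. X \<omega> * \<epsilon> N \<omega>) = 0"
    using indep_past[OF N(1) measurable_lin[of a], of "\<lambda>x. x"] ie mean[OF N(1)] by (simp_all add: lin_past X_def[abs_def])
  have "(lin a (Suc N) (\<lambda>i. \<epsilon> i \<omega>))\<^sup>2 = (X \<omega>)\<^sup>2 + ((a N)\<^sup>2 * (\<epsilon> N \<omega>)\<^sup>2 + 2 * a N * (X \<omega> * \<epsilon> N \<omega>))" for \<omega>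
    by (simp add: lin_def X_def power2_sum power_mult_distrib algebra_simps)
  then have "expectation (\<lambda>\<omega>. (lin a (Suc N) (\<lambda>i. \<epsilon> i \<omega>))\<^sup>2) =
      expectation (\<lambda>\<omega>. (X \<omega>)\<^sup>2) + ((a N)\<^sup>2 * \<sigma>\<^sup>2)"
    using iX2 ie2 cross second_moment[OF N(1)] by simp
  then show ?case using Suc N by (simp add: X_def algebra_simps)
qed (simp add: lin_def)

text \<open>
  The part of the centred quadratic form \<open>\<Sum>\<^sub>i\<^sub>,\<^sub>k P i k (x i x k) - \<sigma>\<^sup>2 \<Sum>\<^sub>k P k k\<close> that the variable \<open>x k\<close> adds to
  the form in the earlier variables (\<open>quad_eq\<close>).
\<close>
definition quad_incr :: "(nat \<Rightarrow> nat \<Rightarrow> real) \<Rightarrow> nat \<Rightarrow> (nat \<Rightarrow> real) \<Rightarrow> real" where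
  "quad_incr P k x = P k k * ((x k)\<^sup>2 - \<sigma>\<^sup>2) + 2 * (lin (\<lambda>i. P i k) k x * x k)"

definition quad :: "(nat \<Rightarrow> nat \<Rightarrow> real) \<Rightarrow> nat \<Rightarrow> (nat \<Rightarrow> real) \<Rightarrow> real" where
  "quad P N x = (\<Sum>k<N. quad_incr P k x)"

lemma quad_eq:
  assumes "\<And>i k. P i k = P k i"
  shows "quad P N x = (\<Sum>i<N. \<Sum>k<N. P i k * (x i * x k)) - \<sigma>\<^sup>2 * (\<Sum>k<N. P k k)"
proof -
  have "(\<Sum>i<N. \<Sum>k<N. P i k * (x i * x k)) = (\<Sum>k<N. P k k * (x k * x k) + 2 * (\<Sum>i<k. P i k * (x i * x k)))"
    using assms by (intro sum_symmetric) (simp add: mult_ac)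
  then show ?thesis
    by (simp add: quad_def quad_incr_def lin_def power2_eq_square sum_distrib_left sum_distrib_right
        sum_subtractf sum.distrib algebra_simps)
qed

lemma quad_incr_cong: "(\<And>i. i \<le> k \<Longrightarrow> x i = y i) \<Longrightarrow> quad_incr P k x = quad_incr P k y"
  by (simp add: quad_incr_def lin_def)

lemma quad_past: "quad P N (past N \<omega>) = quad P N (\<lambda>i. \<epsilon> i \<omega>)"
  unfolding quad_def by (intro sum.cong quad_incr_cong) (auto simp: past_def)

lemma measurable_quad: "quad P N \<in> borel_measurable (PiM {..<N} (\<lambda>_. borel))"
proof -
  have c: "(\<lambda>x. x i) \<in> borel_measurable (PiM {..<N} (\<lambda>_. borel))" if "i < N" for i :: nat
    using measurable_component_singleton[of i "{..<N}" "\<lambda>_. borel"] that by simp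
  have "quad_incr P k \<in> borel_measurable (PiM {..<N} (\<lambda>_. borel))" if "k < N" for k
    unfolding quad_incr_def[abs_def] lin_def using c that
    by (intro borel_measurable_add borel_measurable_times borel_measurable_diff borel_measurable_power
        borel_measurable_sum borel_measurable_const) auto
  then show ?thesis unfolding quad_def[abs_def] by (intro borel_measurable_sum) auto
qed

lemma square_integrable_lin_times_noise:
  assumes "N < n"
  shows "square_integrable M (\<lambda>\<omega>. lin a N (\<lambda>i. \<epsilon> i \<omega>) * \<epsilon> N \<omega>)"
    and "expectation (\<lambda>\<omega>. (lin a N (\<lambda>i. \<epsilon> i \<omega>) * \<epsilon> N \<omega>)\<^sup>2) = \<sigma> ^ 4 * (\<Sum>i<N. (a i)\<^sup>2)"
proof -
  have l: "square_integrable M (\<lambda>\<omega>. lin a N (\<lambda>i. \<epsilon> i \<omega>))" using assms by (intro square_integrable_lin) auto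
  have e: "square_integrable M (\<epsilon> N)" using assms by (rule square_integrable_noise)
  have m: "(\<lambda>x. (lin a N x)\<^sup>2) \<in> borel_measurable (PiM {..<N} (\<lambda>_. borel))"
    using measurable_lin by measurable
  note * = indep_past[OF assms m, of "\<lambda>x. x\<^sup>2"]
  have "integrable M (\<lambda>\<omega>. (lin a N (\<lambda>i. \<epsilon> i \<omega>))\<^sup>2 * (\<epsilon> N \<omega>)\<^sup>2)"
    using * l e by (auto simp: square_integrable_def lin_past)
  moreover have "expectation (\<lambda>\<omega>. (lin a N (\<lambda>i. \<epsilon> i \<omega>))\<^sup>2 * (\<epsilon> N \<omega>)\<^sup>2) = (\<sigma>\<^sup>2 * (\<Sum>i<N. (a i)\<^sup>2)) * \<sigma>\<^sup>2"
    using * l e assms by (auto simp: square_integrable_def lin_past lin_second_moment second_moment)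
  ultimately show "square_integrable M (\<lambda>\<omega>. lin a N (\<lambda>i. \<epsilon> i \<omega>) * \<epsilon> N \<omega>)"
    and "expectation (\<lambda>\<omega>. (lin a N (\<lambda>i. \<epsilon> i \<omega>) * \<epsilon> N \<omega>)\<^sup>2) = \<sigma> ^ 4 * (\<Sum>i<N. (a i)\<^sup>2)"
    using l e by (auto simp: square_integrable_def power_mult_distrib algebra_simps power2_eq_square power4_eq_xxxx)
qed

lemma square_integrable_centred_sq:
  assumes "N < n"
  shows "square_integrable M (\<lambda>\<omega>. (\<epsilon> N \<omega>)\<^sup>2 - \<sigma>\<^sup>2)"
    and "expectation (\<lambda>\<omega>. ((\<epsilon> N \<omega>)\<^sup>2 - \<sigma>\<^sup>2)\<^sup>2) \<le> \<kappa> * \<sigma> ^ 4"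
proof -
  have e: "square_integrable M (\<lambda>\<omega>. (\<epsilon> N \<omega>)\<^sup>2)" using assms by (rule square_integrable_noise_sq)
  show "square_integrable M (\<lambda>\<omega>. (\<epsilon> N \<omega>)\<^sup>2 - \<sigma>\<^sup>2)"
    using square_integrable_add[OF e square_integrable_const[of "- \<sigma>\<^sup>2"]] by simp
  have "((\<epsilon> N \<omega>)\<^sup>2 - \<sigma>\<^sup>2)\<^sup>2 = \<epsilon> N \<omega> ^ 4 + (\<sigma> ^ 4 - 2 * \<sigma>\<^sup>2 * (\<epsilon> N \<omega>)\<^sup>2)" for \<omega>
    by (simp add: power2_eq_square power4_eq_xxxx algebra_simps)
  then have "expectation (\<lambda>\<omega>. ((\<epsilon> N \<omega>)\<^sup>2 - \<sigma>\<^sup>2)\<^sup>2) = expectation (\<lambda>\<omega>. \<epsilon> N \<omega> ^ 4) + (\<sigma> ^ 4 - 2 * \<sigma>\<^sup>2 * \<sigma>\<^sup>2)"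
    using integrable4[OF assms] square_integrable_integrable[OF e] second_moment[OF assms]
    by (simp add: prob_space)
  also have "\<sigma> ^ 4 - 2 * \<sigma>\<^sup>2 * \<sigma>\<^sup>2 = - (\<sigma>\<^sup>2)\<^sup>2"
    by (simp add: power2_eq_square power4_eq_xxxx)
  also have "expectation (\<lambda>\<omega>. \<epsilon> N \<omega> ^ 4) + - (\<sigma>\<^sup>2)\<^sup>2 \<le> \<kappa> * \<sigma> ^ 4"
    using fourth_moment[OF assms] zero_le_power2[of "\<sigma>\<^sup>2"] by linarith
  finally show "expectation (\<lambda>\<omega>. ((\<epsilon> N \<omega>)\<^sup>2 - \<sigma>\<^sup>2)\<^sup>2) \<le> \<kappa> * \<sigma> ^ 4" .
qed

lemma square_integrable_quad_incr:
  assumes "N < n"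
  shows "square_integrable M (\<lambda>\<omega>. quad_incr P N (\<lambda>i. \<epsilon> i \<omega>))"
    and "expectation (\<lambda>\<omega>. (quad_incr P N (\<lambda>i. \<epsilon> i \<omega>))\<^sup>2)
      \<le> (2 * \<kappa> + 4) * \<sigma> ^ 4 * ((P N N)\<^sup>2 + 2 * (\<Sum>i<N. (P i N)\<^sup>2))"
proof -
  define U where "U \<omega> = (\<epsilon> N \<omega>)\<^sup>2 - \<sigma>\<^sup>2" for \<omega>
  define V where "V \<omega> = lin (\<lambda>i. P i N) N (\<lambda>i. \<epsilon> i \<omega>) * \<epsilon> N \<omega>" for \<omega>
  have U: "square_integrable M U" "expectation (\<lambda>\<omega>. (U \<omega>)\<^sup>2) \<le> \<kappa> * \<sigma> ^ 4"
    unfolding U_def using square_integrable_centred_sq[OF assms] by auto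
  have V: "square_integrable M V" "expectation (\<lambda>\<omega>. (V \<omega>)\<^sup>2) = \<sigma> ^ 4 * (\<Sum>i<N. (P i N)\<^sup>2)"
    unfolding V_def using square_integrable_lin_times_noise[OF assms] by auto
  have q: "quad_incr P N (\<lambda>i. \<epsilon> i \<omega>) = P N N * U \<omega> + 2 * V \<omega>" for \<omega>
    by (simp add: quad_incr_def U_def V_def)
  show si: "square_integrable M (\<lambda>\<omega>. quad_incr P N (\<lambda>i. \<epsilon> i \<omega>))"
    unfolding q using U V by (intro square_integrable_add square_integrable_cmult)
  have "expectation (\<lambda>\<omega>. (quad_incr P N (\<lambda>i. \<epsilon> i \<omega>))\<^sup>2)
      \<le> expectation (\<lambda>\<omega>. 2 * (P N N)\<^sup>2 * (U \<omega>)\<^sup>2 + 8 * (V \<omega>)\<^sup>2)"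
  proof (rule integral_mono)
    show "integrable M (\<lambda>\<omega>. (quad_incr P N (\<lambda>i. \<epsilon> i \<omega>))\<^sup>2)" using si by (simp add: square_integrable_def)
    show "integrable M (\<lambda>\<omega>. 2 * (P N N)\<^sup>2 * (U \<omega>)\<^sup>2 + 8 * (V \<omega>)\<^sup>2)" using U V by (simp add: square_integrable_def)
    have "(a * u + 2 * v)\<^sup>2 \<le> 2 * a\<^sup>2 * u\<^sup>2 + 8 * v\<^sup>2" for a u v :: real
      using zero_le_power2[of "a * u - 2 * v"] by (simp add: power2_eq_square algebra_simps)
    then show "(quad_incr P N (\<lambda>i. \<epsilon> i \<omega>))\<^sup>2 \<le> 2 * (P N N)\<^sup>2 * (U \<omega>)\<^sup>2 + 8 * (V \<omega>)\<^sup>2" for \<omega>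
      by (simp add: q)
  qed
  also have "\<dots> = 2 * (P N N)\<^sup>2 * expectation (\<lambda>\<omega>. (U \<omega>)\<^sup>2) + 8 * (\<sigma> ^ 4 * (\<Sum>i<N. (P i N)\<^sup>2))"
    using U V by (simp add: square_integrable_def)
  also have "\<dots> \<le> 2 * (P N N)\<^sup>2 * (\<kappa> * \<sigma> ^ 4) + 8 * (\<sigma> ^ 4 * (\<Sum>i<N. (P i N)\<^sup>2))"
    using U by (intro add_right_mono mult_left_mono) auto
  also have "\<dots> \<le> (2 * \<kappa> + 4) * \<sigma> ^ 4 * ((P N N)\<^sup>2 + 2 * (\<Sum>i<N. (P i N)\<^sup>2))"
  proof -
    have "0 \<le> \<sigma> ^ 4 * (P N N)\<^sup>2" "0 \<le> \<kappa> * (\<sigma> ^ 4 * (\<Sum>i<N. (P i N)\<^sup>2))"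
      using kappa_nonneg by (auto intro!: mult_nonneg_nonneg sum_nonneg)
    then show ?thesis by (simp add: algebra_simps)
  qed
  finally show "expectation (\<lambda>\<omega>. (quad_incr P N (\<lambda>i. \<epsilon> i \<omega>))\<^sup>2)
      \<le> (2 * \<kappa> + 4) * \<sigma> ^ 4 * ((P N N)\<^sup>2 + 2 * (\<Sum>i<N. (P i N)\<^sup>2))" .
qed

lemma square_integrable_quad: "N \<le> n \<Longrightarrow> square_integrable M (\<lambda>\<omega>. quad P N (\<lambda>i. \<epsilon> i \<omega>))"
  unfolding quad_def by (intro square_integrable_sum square_integrable_quad_incr) auto

text \<open>
  The increments are martingale differences: conditionally on the past, both \<open>\<epsilon>\<^sub>k\<^sup>2 - \<sigma>\<^sup>2\<close> and \<open>\<epsilon>\<^sub>k\<close> have mean zero.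
  Hence the second moments of the increments add up.
\<close>
lemma quad_second_moment_incr:
  "N \<le> n \<Longrightarrow> expectation (\<lambda>\<omega>. (quad P N (\<lambda>i. \<epsilon> i \<omega>))\<^sup>2)
    \<le> (2 * \<kappa> + 4) * \<sigma> ^ 4 * (\<Sum>k<N. (P k k)\<^sup>2 + 2 * (\<Sum>i<k. (P i k)\<^sup>2))"
proof (induction N)
  case (Suc N)
  then have N: "N < n" "N \<le> n" by auto
  define q where "q \<omega> = quad P N (\<lambda>i. \<epsilon> i \<omega>)" for \<omega>
  define l where "l \<omega> = lin (\<lambda>i. P i N) N (\<lambda>i. \<epsilon> i \<omega>)" for \<omega>
  define d where "d \<omega> = quad_incr P N (\<lambda>i. \<epsilon> i \<omega>)" for \<omega>
  have q: "square_integrable M q" unfolding q_def using N by (intro square_integrable_quad)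
  have l: "square_integrable M l" unfolding l_def using N by (intro square_integrable_lin)
  have d: "square_integrable M d" unfolding d_def using N by (intro square_integrable_quad_incr)
  have U: "square_integrable M (\<lambda>\<omega>. (\<epsilon> N \<omega>)\<^sup>2 - \<sigma>\<^sup>2)" using square_integrable_centred_sq N by auto
  have EU: "expectation (\<lambda>\<omega>. (\<epsilon> N \<omega>)\<^sup>2 - \<sigma>\<^sup>2) = 0"
    using second_moment[OF N(1)] square_integrable_integrable[OF square_integrable_noise_sq[OF N(1)]]
    by (simp add: prob_space)
  have 1: "integrable M (\<lambda>\<omega>. q \<omega> * ((\<epsilon> N \<omega>)\<^sup>2 - \<sigma>\<^sup>2))" "expectation (\<lambda>\<omega>. q \<omega> * ((\<epsilon> N \<omega>)\<^sup>2 - \<sigma>\<^sup>2)) = 0"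
    using indep_past[OF N(1) measurable_quad[of P], of "\<lambda>x. x\<^sup>2 - \<sigma>\<^sup>2"] EU
      square_integrable_integrable[OF U] square_integrable_integrable[OF q]
    by (simp_all add: quad_past q_def[abs_def])
  have m: "(\<lambda>x. quad P N x * lin (\<lambda>i. P i N) N x) \<in> borel_measurable (PiM {..<N} (\<lambda>_. borel))"
    using measurable_quad measurable_lin by measurable
  have 2: "integrable M (\<lambda>\<omega>. q \<omega> * l \<omega> * \<epsilon> N \<omega>)" "expectation (\<lambda>\<omega>. q \<omega> * l \<omega> * \<epsilon> N \<omega>) = 0"
    using indep_past[OF N(1) m, of "\<lambda>x. x"] mean[OF N(1)] square_integrable_mult[OF q l]
      square_integrable_integrable[OF square_integrable_noise[OF N(1)]]
    by (simp_all add: quad_past lin_past q_def[abs_def] l_def[abs_def])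
  have "q \<omega> * d \<omega> = P N N * (q \<omega> * ((\<epsilon> N \<omega>)\<^sup>2 - \<sigma>\<^sup>2)) + 2 * (q \<omega> * l \<omega> * \<epsilon> N \<omega>)" for \<omega>
    by (simp add: d_def quad_incr_def l_def algebra_simps)
  then have cross: "expectation (\<lambda>\<omega>. q \<omega> * d \<omega>) = 0" "integrable M (\<lambda>\<omega>. q \<omega> * d \<omega>)"
    using 1 2 by simp_all
  have "(quad P (Suc N) (\<lambda>i. \<epsilon> i \<omega>))\<^sup>2 = (q \<omega>)\<^sup>2 + ((d \<omega>)\<^sup>2 + 2 * (q \<omega> * d \<omega>))" for \<omega>
    by (simp add: quad_def q_def d_def power2_sum)
  then have "expectation (\<lambda>\<omega>. (quad P (Suc N) (\<lambda>i. \<epsilon> i \<omega>))\<^sup>2) = expectation (\<lambda>\<omega>. (q \<omega>)\<^sup>2) + expectation (\<lambda>\<omega>. (d \<omega>)\<^sup>2)"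
    using q d cross by (simp add: square_integrable_def)
  also have "\<dots> \<le> (2 * \<kappa> + 4) * \<sigma> ^ 4 * (\<Sum>k<N. (P k k)\<^sup>2 + 2 * (\<Sum>i<k. (P i k)\<^sup>2))
      + (2 * \<kappa> + 4) * \<sigma> ^ 4 * ((P N N)\<^sup>2 + 2 * (\<Sum>i<N. (P i N)\<^sup>2))"
    using Suc N square_integrable_quad_incr(2)[OF N(1), of P] by (intro add_mono) (auto simp: q_def d_def)
  finally show ?case by (simp add: distrib_left)
qed (simp add: quad_def)

lemma quad_second_moment:
  assumes "\<And>i k. P i k = P k i"
  shows "expectation (\<lambda>\<omega>. (quad P n (\<lambda>i. \<epsilon> i \<omega>))\<^sup>2) \<le> (2 * \<kappa> + 4) * \<sigma> ^ 4 * (\<Sum>i<n. \<Sum>k<n. (P i k)\<^sup>2)"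
proof -
  have "(\<Sum>i<n. \<Sum>k<n. (P i k)\<^sup>2) = (\<Sum>k<n. (P k k)\<^sup>2 + 2 * (\<Sum>i<k. (P i k)\<^sup>2))"
    using assms by (intro sum_symmetric) simp
  then show ?thesis using quad_second_moment_incr[of n P] by simp
qed

end

section \<open>Risk comparison for nested models\<close>

text \<open>
  As functions of the shrinkage factors, loss and criterion differ only in a linear term.  It produces the first part
  of each summand; the second part is the gain from the minimality of the criterion in \<open>quadratic_min_strongly_convex\<close>.
\<close>
lemma (in orthogonal_regression) mma_loss_le:
  assumes fin: "finite \<M>" and sub: "\<M> \<subseteq> Pow {1..p}" and y: "y \<in> carrier_vec n"
    and min: "is_arg_min (mallows_criterion n \<psi> \<M> s y) (\<lambda>v. v \<in> weights \<M>) w"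
    and v: "v \<in> weights \<M>"
  defines "d \<equiv> \<lambda>j. shrinkage \<M> w j - shrinkage \<M> v j"
  shows "loss n (avg_est n \<psi> \<M> w y) (comb \<theta>) \<le> loss n (avg_est n \<psi> \<M> v y) (comb \<theta>)
    + (\<Sum>j=1..p. 2 * d j * (coord j y * (coord j y - \<theta> j) - s / real n) - (coord j y)\<^sup>2 * (d j)\<^sup>2)"
proof -
  let ?w = "shrinkage \<M> w" and ?v = "shrinkage \<M> v" and ?c = "\<lambda>j. coord j y"
  define b where "b j = (?c j)\<^sup>2 - s / real n" for j
  define F where "F = (\<lambda>z::nat\<Rightarrow>real. \<Sum>j=1..p. (z j)\<^sup>2 * (?c j)\<^sup>2 - 2 * z j * b j)"
  have w: "w \<in> weights \<M>" using min by (simp add: is_arg_min_linorder)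
  have crit: "mallows_criterion n \<psi> \<M> s y u = sqnorm y / real n + F (shrinkage \<M> u)" for u
    unfolding mallows_criterion_eq[OF fin sub y] F_def b_def by simp
  have "F ?w + (\<Sum>j=1..p. (?c j)\<^sup>2 * (?v j - ?w j)\<^sup>2) \<le> F ?v"
    unfolding F_def
  proof (rule quadratic_min_strongly_convex)
    fix \<tau> :: real assume \<tau>: "0 \<le> \<tau>" "\<tau> \<le> 1"
    define u where "u = (\<lambda>I. w I + \<tau> * (v I - w I))"
    have "u \<in> weights \<M>" unfolding u_def by (rule weights_mix[OF fin w v \<tau>])
    then have "F ?w \<le> F (shrinkage \<M> u)"
      using min unfolding is_arg_min_linorder crit by auto
    also have "shrinkage \<M> u = (\<lambda>j. ?w j + \<tau> * (?v j - ?w j))"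
      by (rule ext) (simp only: u_def shrinkage_mix)
    finally show "(\<Sum>j=1..p. (?w j)\<^sup>2 * (?c j)\<^sup>2 - 2 * ?w j * b j)
        \<le> (\<Sum>j=1..p. (?w j + \<tau> * (?v j - ?w j))\<^sup>2 * (?c j)\<^sup>2 - 2 * (?w j + \<tau> * (?v j - ?w j)) * b j)"
      unfolding F_def .
  qed simp
  moreover have "(\<Sum>j=1..p. (?w j * ?c j - \<theta> j)\<^sup>2) - (\<Sum>j=1..p. (?v j * ?c j - \<theta> j)\<^sup>2)
      = F ?w - F ?v + (\<Sum>j=1..p. 2 * d j * (?c j * (?c j - \<theta> j) - s / real n))"
    unfolding F_def sum_subtractf[symmetric] sum.distrib[symmetric]
    by (intro sum.cong refl) (simp add: b_def d_def power2_eq_square algebra_simps)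
  moreover have "(\<Sum>j=1..p. (?c j)\<^sup>2 * (?v j - ?w j)\<^sup>2) = (\<Sum>j=1..p. (?c j)\<^sup>2 * (d j)\<^sup>2)"
    by (simp add: d_def power2_commute)
  ultimately show ?thesis
    unfolding loss_avg_est[OF fin sub y] sum_subtractf by linarith
qed

locale noisy_regression = orthogonal_regression n p \<psi> + centred_noise M n \<epsilon> \<sigma> \<kappa>
  for n p :: nat and \<psi> :: "nat \<Rightarrow> real vec" and M :: "'a measure" and \<epsilon> :: "nat \<Rightarrow> 'a \<Rightarrow> real" and \<sigma> \<kappa> :: real
begin

definition err :: "nat \<Rightarrow> 'a \<Rightarrow> real" where
  "err j \<omega> = coord j (Matrix.vec n (\<lambda>i. \<epsilon> i \<omega>))"

lemma err_eq: "err j \<omega> = (\<Sum>i<n. entry j i * \<epsilon> i \<omega>) / real n"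
  by (simp add: err_def coord_eq)

lemma obs_carrier: "obs n \<epsilon> (comb \<theta>) \<omega> \<in> carrier_vec n"
  by (simp add: obs_def)

lemma coord_obs: "j \<in> {1..p} \<Longrightarrow> coord j (obs n \<epsilon> (comb \<theta>) \<omega>) = \<theta> j + err j \<omega>"
  by (simp only: obs_def coord_add[OF _ comb_carrier vec_carrier] coord_comb err_def)

lemma linear_err_eq:
  "(\<Sum>j\<in>B. \<theta> j * err j \<omega>) = lin (\<lambda>i. (\<Sum>j\<in>B. \<theta> j * entry j i) / real n) n (\<lambda>i. \<epsilon> i \<omega>)"
proof -
  have "(\<Sum>j\<in>B. \<theta> j * err j \<omega>) = (\<Sum>j\<in>B. \<Sum>i<n. \<theta> j * entry j i / real n * \<epsilon> i \<omega>)"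
    unfolding err_eq sum_divide_distrib sum_distrib_left by (intro sum.cong refl) simp
  also have "\<dots> = (\<Sum>i<n. \<Sum>j\<in>B. \<theta> j * entry j i / real n * \<epsilon> i \<omega>)" by (rule sum.swap)
  finally show ?thesis unfolding lin_def sum_divide_distrib sum_distrib_right .
qed

lemma square_integrable_linear_err: "square_integrable M (\<lambda>\<omega>. \<Sum>j\<in>B. \<theta> j * err j \<omega>)"
  unfolding linear_err_eq by (rule square_integrable_lin) simp

lemma linear_err_mean: "expectation (\<lambda>\<omega>. \<Sum>j\<in>B. \<theta> j * err j \<omega>) = 0"
  unfolding linear_err_eq by (rule lin_mean) simp

lemma sum_entry_products:
  assumes B: "B \<subseteq> {1..p}"
  shows "(\<Sum>i<n. (\<Sum>j\<in>B. \<theta> j * entry j i)\<^sup>2) = real n * (\<Sum>j\<in>B. (\<theta> j)\<^sup>2)"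
proof -
  have fin: "finite B" using B finite_subset by blast
  have "(\<Sum>i<n. (\<Sum>j\<in>B. \<theta> j * entry j i)\<^sup>2) = (\<Sum>i<n. \<Sum>j\<in>B. \<Sum>k\<in>B. \<theta> j * \<theta> k * (entry j i * entry k i))"
    unfolding power2_eq_square sum_product by (intro sum.cong refl) simp
  also have "\<dots> = (\<Sum>j\<in>B. \<Sum>i<n. \<Sum>k\<in>B. \<theta> j * \<theta> k * (entry j i * entry k i))" by (rule sum.swap)
  also have "\<dots> = (\<Sum>j\<in>B. \<Sum>k\<in>B. \<Sum>i<n. \<theta> j * \<theta> k * (entry j i * entry k i))"
    by (rule sum.cong[OF refl]) (rule sum.swap)
  also have "\<dots> = (\<Sum>j\<in>B. \<Sum>k\<in>B. if j = k then real n * (\<theta> k)\<^sup>2 else 0)"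
  proof (intro sum.cong refl)
    fix j k assume "j \<in> B" "k \<in> B"
    then have "(\<Sum>i<n. entry j i * entry k i) = (if j = k then real n else 0)"
      using B by (intro entry_orthogonal) auto
    then show "(\<Sum>i<n. \<theta> j * \<theta> k * (entry j i * entry k i)) = (if j = k then real n * (\<theta> k)\<^sup>2 else 0)"
      unfolding sum_distrib_left[symmetric] by (simp add: power2_eq_square)
  qed
  also have "\<dots> = (\<Sum>j\<in>B. real n * (\<theta> j)\<^sup>2)"
    using fin by (intro sum.cong refl) (simp add: sum.delta')
  finally show ?thesis by (simp add: sum_distrib_left)
qed

lemma linear_err_second_moment:
  assumes B: "B \<subseteq> {1..p}"
  shows "expectation (\<lambda>\<omega>. (\<Sum>j\<in>B. \<theta> j * err j \<omega>)\<^sup>2) = \<sigma>\<^sup>2 / real n * (\<Sum>j\<in>B. (\<theta> j)\<^sup>2)"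
proof -
  have "expectation (\<lambda>\<omega>. (\<Sum>j\<in>B. \<theta> j * err j \<omega>)\<^sup>2) = \<sigma>\<^sup>2 * (\<Sum>i<n. ((\<Sum>j\<in>B. \<theta> j * entry j i) / real n)\<^sup>2)"
    unfolding linear_err_eq by (rule lin_second_moment) simp
  also have "(\<Sum>i<n. ((\<Sum>j\<in>B. \<theta> j * entry j i) / real n)\<^sup>2) = (\<Sum>j\<in>B. (\<theta> j)\<^sup>2) / real n"
    unfolding power_divide sum_divide_distrib[symmetric] sum_entry_products[OF B]
    using dims by (simp add: power2_eq_square)
  finally show ?thesis by simp
qed

lemma err_moments:
  assumes "j \<in> {1..p}"
  shows "square_integrable M (err j)" "expectation (err j) = 0" "expectation (\<lambda>\<omega>. (err j \<omega>)\<^sup>2) = \<sigma>\<^sup>2 / real n"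
  using square_integrable_linear_err[of "\<lambda>_. 1" "{j}"] linear_err_mean[of "\<lambda>_. 1" "{j}"]
    linear_err_second_moment[of "{j}" "\<lambda>_. 1"] assms by simp_all

text \<open>
  The sum of squares is the quadratic form with matrix \<open>\<Sum>\<^sub>j \<psi>\<^sub>j \<psi>\<^sub>j\<^sup>T / n\<^sup>2\<close>, which is \<open>1 / n\<close> times an orthogonal projection
  of rank \<open>card B\<close>; this gives its trace and its Frobenius norm.
\<close>
lemma square_err_moments:
  assumes B: "B \<subseteq> {1..p}"
  defines "q \<equiv> \<lambda>\<omega>. (\<Sum>j\<in>B. (err j \<omega>)\<^sup>2) - \<sigma>\<^sup>2 * real (card B) / real n"
  shows "square_integrable M q"
    and "expectation (\<lambda>\<omega>. (q \<omega>)\<^sup>2) \<le> (2 * \<kappa> + 4) * \<sigma> ^ 4 * real (card B) / (real n)\<^sup>2"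
proof -
  have fin: "finite B" using B finite_subset by blast
  define P where "P i k = (\<Sum>j\<in>B. entry j i * entry j k) / (real n)\<^sup>2" for i k
  have sym: "P i k = P k i" for i k by (simp add: P_def mult.commute)
  have trace: "(\<Sum>k<n. P k k) = real (card B) / real n"
  proof -
    have "(\<Sum>k<n. \<Sum>j\<in>B. entry j k * entry j k) = (\<Sum>j\<in>B. \<Sum>k<n. entry j k * entry j k)" by (rule sum.swap)
    also have "\<dots> = (\<Sum>j\<in>B. real n)"
      using B entry_orthogonal by (intro sum.cong refl) (auto simp: subset_eq)
    finally show ?thesis
      unfolding P_def sum_divide_distrib[symmetric] using dims by (simp add: power2_eq_square)
  qed
  have frobenius: "(\<Sum>i<n. \<Sum>k<n. (P i k)\<^sup>2) = real (card B) / (real n)\<^sup>2"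
  proof -
    have "(\<Sum>i<n. \<Sum>k<n. (\<Sum>j\<in>B. entry j i * entry j k)\<^sup>2) = (\<Sum>i<n. real n * (\<Sum>j\<in>B. (entry j i)\<^sup>2))"
      by (intro sum.cong refl sum_entry_products[OF B])
    also have "\<dots> = real n * (\<Sum>i<n. \<Sum>j\<in>B. (entry j i)\<^sup>2)" by (simp only: sum_distrib_left)
    also have "(\<Sum>i<n. \<Sum>j\<in>B. (entry j i)\<^sup>2) = (\<Sum>j\<in>B. \<Sum>i<n. (entry j i)\<^sup>2)" by (rule sum.swap)
    also have "\<dots> = (\<Sum>j\<in>B. real n)"
      using B entry_orthogonal by (intro sum.cong refl) (auto simp: subset_eq power2_eq_square)
    finally have "(\<Sum>i<n. \<Sum>k<n. (\<Sum>j\<in>B. entry j i * entry j k)\<^sup>2) = (real n)\<^sup>2 * real (card B)"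
      by (simp add: power2_eq_square)
    then show ?thesis
      unfolding P_def power_divide sum_divide_distrib[symmetric] using dims by (simp add: power2_eq_square)
  qed
  have q: "q \<omega> = quad P n (\<lambda>i. \<epsilon> i \<omega>)" for \<omega>
  proof -
    have "(\<Sum>i<n. \<Sum>k<n. P i k * (\<epsilon> i \<omega> * \<epsilon> k \<omega>)) = (\<Sum>i<n. \<Sum>k<n. \<Sum>j\<in>B. (entry j i * \<epsilon> i \<omega> / real n) * (entry j k * \<epsilon> k \<omega> / real n))"
      unfolding P_def sum_divide_distrib sum_distrib_right by (intro sum.cong refl) (simp add: power2_eq_square)
    also have "\<dots> = (\<Sum>i<n. \<Sum>j\<in>B. \<Sum>k<n. (entry j i * \<epsilon> i \<omega> / real n) * (entry j k * \<epsilon> k \<omega> / real n))"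
      by (rule sum.cong[OF refl]) (rule sum.swap)
    also have "\<dots> = (\<Sum>j\<in>B. \<Sum>i<n. \<Sum>k<n. (entry j i * \<epsilon> i \<omega> / real n) * (entry j k * \<epsilon> k \<omega> / real n))"
      by (rule sum.swap)
    also have "\<dots> = (\<Sum>j\<in>B. (err j \<omega>)\<^sup>2)"
      unfolding err_eq sum_divide_distrib power2_eq_square sum_product ..
    finally show ?thesis by (simp add: quad_eq[of P, OF sym] trace q_def)
  qed
  show "square_integrable M q" unfolding q by (rule square_integrable_quad) simp
  show "expectation (\<lambda>\<omega>. (q \<omega>)\<^sup>2) \<le> (2 * \<kappa> + 4) * \<sigma> ^ 4 * real (card B) / (real n)\<^sup>2"
    unfolding q using quad_second_moment[of P, OF sym] frobenius by simp
qed

lemma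
  assumes fin: "finite \<M>" and sub: "\<M> \<subseteq> Pow {1..p}"
  shows integrable_loss: "integrable M (\<lambda>\<omega>. loss n (avg_est n \<psi> \<M> w (obs n \<epsilon> (comb \<theta>) \<omega>)) (comb \<theta>))"
    and risk_avg_est: "risk M n \<epsilon> (avg_est n \<psi> \<M> w) (comb \<theta>) =
      (\<Sum>j=1..p. (1 - shrinkage \<M> w j)\<^sup>2 * (\<theta> j)\<^sup>2) + \<sigma>\<^sup>2 / real n * (\<Sum>j=1..p. (shrinkage \<M> w j)\<^sup>2)"
proof -
  let ?g = "shrinkage \<M> w"
  define f where "f j \<omega> = (1 - ?g j)\<^sup>2 * (\<theta> j)\<^sup>2 - 2 * ?g j * (1 - ?g j) * \<theta> j * err j \<omega> + (?g j)\<^sup>2 * (err j \<omega>)\<^sup>2" for j \<omega>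
  have loss: "loss n (avg_est n \<psi> \<M> w (obs n \<epsilon> (comb \<theta>) \<omega>)) (comb \<theta>) = (\<Sum>j=1..p. f j \<omega>)" for \<omega>
    unfolding loss_avg_est[OF fin sub obs_carrier]
    by (intro sum.cong refl) (simp add: coord_obs f_def power2_eq_square algebra_simps)
  have int: "integrable M (err j)" "integrable M (\<lambda>\<omega>. (err j \<omega>)\<^sup>2)" if "j \<in> {1..p}" for j
    using square_integrable_integrable[OF err_moments(1)[OF that]] err_moments(1)[OF that]
    by (simp_all add: square_integrable_def)
  have f: "integrable M (f j)" "expectation (f j) = (1 - ?g j)\<^sup>2 * (\<theta> j)\<^sup>2 + (?g j)\<^sup>2 * (\<sigma>\<^sup>2 / real n)" if "j \<in> {1..p}" for j
    using int[OF that] err_moments(2,3)[OF that] by (simp_all add: f_def[abs_def] prob_space)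
  show "integrable M (\<lambda>\<omega>. loss n (avg_est n \<psi> \<M> w (obs n \<epsilon> (comb \<theta>) \<omega>)) (comb \<theta>))"
    unfolding loss using f by (intro Bochner_Integration.integrable_sum)
  have "risk M n \<epsilon> (avg_est n \<psi> \<M> w) (comb \<theta>) = (\<Sum>j=1..p. expectation (f j))"
    unfolding risk_def loss using f by (intro Bochner_Integration.integral_sum)
  also have "\<dots> = (\<Sum>j=1..p. (1 - ?g j)\<^sup>2 * (\<theta> j)\<^sup>2 + \<sigma>\<^sup>2 / real n * (?g j)\<^sup>2)"
    using f(2) by (intro sum.cong refl) (simp add: mult.commute)
  finally show "risk M n \<epsilon> (avg_est n \<psi> \<M> w) (comb \<theta>) =
      (\<Sum>j=1..p. (1 - ?g j)\<^sup>2 * (\<theta> j)\<^sup>2) + \<sigma>\<^sup>2 / real n * (\<Sum>j=1..p. (?g j)\<^sup>2)"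
    by (simp only: sum.distrib sum_distrib_left)
qed

end

locale nested_regression = noisy_regression n p \<psi> M \<epsilon> \<sigma> \<kappa> + nested_blocks J m p
  for n p :: nat and \<psi> :: "nat \<Rightarrow> real vec" and M :: "'a measure" and \<epsilon> :: "nat \<Rightarrow> 'a \<Rightarrow> real" and \<sigma> \<kappa> :: real
    and J :: "nat \<Rightarrow> nat" and m :: nat
begin

text \<open>
  The additive term is the variance that \<open>D\<close> further coordinates would contribute.
\<close>
lemma risk_round_up:
  assumes w: "w \<in> weights (all_nested p)" and "1 \<le> m" "0 \<le> \<rho>" "0 \<le> D"
    and step: "\<And>t. t < m \<Longrightarrow> real (J (Suc t)) \<le> (1 + \<rho>) * real (J t) + D"
  shows "risk M n \<epsilon> (avg_est n \<psi> models (round_up w)) (comb \<theta>)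
    \<le> (1 + \<rho>) * risk M n \<epsilon> (avg_est n \<psi> (all_nested p) w) (comb \<theta>) + \<sigma>\<^sup>2 * D / real n"
proof -
  have AN: "finite (all_nested p)" "all_nested p \<subseteq> Pow {1..p}" by (auto simp: all_nested_def)
  let ?b = "(\<Sum>j=1..p. (1 - shrinkage (all_nested p) w j)\<^sup>2 * (\<theta> j)\<^sup>2)"
  let ?v = "(\<Sum>j=1..p. (shrinkage (all_nested p) w j)\<^sup>2)"
  have "risk M n \<epsilon> (avg_est n \<psi> models (round_up w)) (comb \<theta>) \<le> ?b + \<sigma>\<^sup>2 / real n * ((1 + \<rho>) * ?v + D)"
    unfolding risk_avg_est[OF finite_models models_subset]
    by (intro add_mono mult_left_mono bias_round_up variance_round_up w assms(2-4)) (simp_all add: step)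
  also have "\<dots> \<le> (1 + \<rho>) * ?b + \<sigma>\<^sup>2 / real n * ((1 + \<rho>) * ?v + D)"
  proof -
    have "0 \<le> ?b" by (intro sum_nonneg mult_nonneg_nonneg) auto
    then have "?b \<le> (1 + \<rho>) * ?b" using assms(3) by (simp add: algebra_simps)
    then show ?thesis by simp
  qed
  finally show ?thesis unfolding risk_avg_est[OF AN] by (simp add: algebra_simps add_divide_distrib)
qed

definition block :: "nat \<Rightarrow> nat set" where
  "block t = {J t<..J (Suc t)}"

lemma block_subset: "t < m \<Longrightarrow> block t \<subseteq> {1..p}"
  using J_mono[of "Suc t" m] J_m by (auto simp: block_def)

text \<open>
  The bound of \<open>block_excess_bound\<close> for the block \<open>t\<close>, with \<open>\<tau> = 1 / n\<close> and with \<open>S\<close> as the estimate of \<open>\<sigma>\<^sup>2\<close>.  It is free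
  of the weights, so its expectation can be taken although the minimising weights depend on the noise.
\<close>
definition excess :: "(nat \<Rightarrow> real) \<Rightarrow> ('a \<Rightarrow> real) \<Rightarrow> nat \<Rightarrow> 'a \<Rightarrow> real" where
  "excess \<theta> S t \<omega> = (12 * (\<Sum>j\<in>block t. \<theta> j * err j \<omega>)\<^sup>2
     + 7 * ((\<Sum>j\<in>block t. (err j \<omega>)\<^sup>2) - \<sigma>\<^sup>2 * real (card (block t)) / real n)\<^sup>2
     + 3 * (real (card (block t)) * (S \<omega> - \<sigma>\<^sup>2) / real n)\<^sup>2)
     / ((\<Sum>j\<in>block t. (\<theta> j)\<^sup>2) + \<sigma>\<^sup>2 * real (card (block t)) / real n + 1 / real n) + 1 / real n"

lemma mma_loss_le_excess:
  assumes min: "is_arg_min (mallows_criterion n \<psi> models (S \<omega>) (obs n \<epsilon> (comb \<theta>) \<omega>)) (\<lambda>v. v \<in> weights models) w"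
    and v: "v \<in> weights models"
  shows "loss n (avg_est n \<psi> models w (obs n \<epsilon> (comb \<theta>) \<omega>)) (comb \<theta>)
    \<le> loss n (avg_est n \<psi> models v (obs n \<epsilon> (comb \<theta>) \<omega>)) (comb \<theta>) + (\<Sum>t<m. excess \<theta> S t \<omega>)"
proof -
  let ?y = "obs n \<epsilon> (comb \<theta>) \<omega>"
  define d where "d j = shrinkage models w j - shrinkage models v j" for j
  define f where "f j = 2 * d j * (coord j ?y * (coord j ?y - \<theta> j) - S \<omega> / real n) - (coord j ?y)\<^sup>2 * (d j)\<^sup>2" for j
  have w: "w \<in> weights models" using min by (simp add: is_arg_min_linorder)
  have "(\<Sum>j=1..p. f j) = (\<Sum>t<m. \<Sum>j\<in>block t. f j)"
    unfolding block_def by (rule sum_coordinates)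
  also have "\<dots> \<le> (\<Sum>t<m. excess \<theta> S t \<omega>)"
  proof (rule sum_mono)
    fix t assume "t \<in> {..<m}"
    then have t: "t < m" by simp
    define \<delta> where "\<delta> = d (J (Suc t))"
    define k where "k = real (card (block t))"
    define l where "l = (\<Sum>j\<in>block t. \<theta> j * err j \<omega>)"
    define e where "e = (\<Sum>j\<in>block t. (err j \<omega>)\<^sup>2)"
    define a where "a = (\<Sum>j\<in>block t. (\<theta> j)\<^sup>2)"
    have \<delta>: "d j = \<delta>" if "j \<in> block t" for j
      using shrinkage_block[OF t that[unfolded block_def]] by (simp add: d_def \<delta>_def)
    have "\<bar>\<delta>\<bar> \<le> 1"
      using shrinkage_nonneg[OF w, of "J (Suc t)"] shrinkage_le_1[OF finite_models w, of "J (Suc t)"]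
        shrinkage_nonneg[OF v, of "J (Suc t)"] shrinkage_le_1[OF finite_models v, of "J (Suc t)"]
      by (auto simp: \<delta>_def d_def)
    have "(\<Sum>j\<in>block t. f j) = (\<Sum>j\<in>block t. 2 * \<delta> * (\<theta> j * err j \<omega>) + 2 * \<delta> * (err j \<omega>)\<^sup>2 - 2 * \<delta> * (S \<omega> / real n)
        - \<delta>\<^sup>2 * (\<theta> j)\<^sup>2 - 2 * \<delta>\<^sup>2 * (\<theta> j * err j \<omega>) - \<delta>\<^sup>2 * (err j \<omega>)\<^sup>2)"
    proof (rule sum.cong[OF refl])
      fix j assume j: "j \<in> block t"
      then have c: "coord j ?y = \<theta> j + err j \<omega>" using block_subset[OF t] by (intro coord_obs) auto
      show "f j = 2 * \<delta> * (\<theta> j * err j \<omega>) + 2 * \<delta> * (err j \<omega>)\<^sup>2 - 2 * \<delta> * (S \<omega> / real n)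
        - \<delta>\<^sup>2 * (\<theta> j)\<^sup>2 - 2 * \<delta>\<^sup>2 * (\<theta> j * err j \<omega>) - \<delta>\<^sup>2 * (err j \<omega>)\<^sup>2"
        unfolding f_def c \<delta>[OF j] by (simp add: power2_eq_square algebra_simps)
    qed
    also have "\<dots> = 2 * \<delta> * l + 2 * \<delta> * e - 2 * \<delta> * (k * S \<omega> / real n) - \<delta>\<^sup>2 * a - 2 * \<delta>\<^sup>2 * l - \<delta>\<^sup>2 * e"
      unfolding sum.distrib sum_subtractf sum_distrib_left[symmetric] l_def e_def a_def k_def by simp
    also have "\<dots> = 2 * \<delta> * (l + (e - \<sigma>\<^sup>2 * k / real n) - k * (S \<omega> - \<sigma>\<^sup>2) / real n)
        - ((a + \<sigma>\<^sup>2 * k / real n) + 2 * l + (e - \<sigma>\<^sup>2 * k / real n)) * \<delta>\<^sup>2"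
    proof -
      have "k * (S \<omega> - \<sigma>\<^sup>2) / real n = k * S \<omega> / real n - \<sigma>\<^sup>2 * k / real n"
        by (simp add: right_diff_distrib diff_divide_distrib mult.commute)
      moreover have "2 * \<delta> * l + 2 * \<delta> * e - 2 * \<delta> * W - \<delta>\<^sup>2 * a - 2 * \<delta>\<^sup>2 * l - \<delta>\<^sup>2 * e
          = 2 * \<delta> * (l + (e - Q) - (W - Q)) - ((a + Q) + 2 * l + (e - Q)) * \<delta>\<^sup>2" for W Q
        by (simp add: algebra_simps)
      ultimately show ?thesis by (simp only:)
    qed
    also have "\<dots> \<le> excess \<theta> S t \<omega>"
      unfolding excess_def l_def[symmetric] e_def[symmetric] a_def[symmetric] k_def[symmetric]
      using \<open>\<bar>\<delta>\<bar> \<le> 1\<close> dims by (intro block_excess_bound) (auto simp: a_def k_def intro!: add_nonneg_nonneg sum_nonneg)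
    finally show "(\<Sum>j\<in>block t. f j) \<le> excess \<theta> S t \<omega>" .
  qed
  finally show ?thesis
    using mma_loss_le[OF finite_models models_subset obs_carrier min v, of \<theta>] by (simp add: f_def d_def)
qed

lemma excess_nonneg: "0 \<le> excess \<theta> S t \<omega>"
  unfolding excess_def by (intro add_nonneg_nonneg divide_nonneg_nonneg sum_nonneg mult_nonneg_nonneg) auto

text \<open>
  Each second moment in the numerator has a factor that the denominator dominates: \<open>l\<close> and \<open>q\<close> have variance at most
  \<open>O(\<sigma>\<^sup>2 / n)\<close> times the signal and the noise level of the block, and the squared block size in the last term
  contains one factor for the denominator and one that sums to \<open>p\<close> over the blocks.  Here \<open>l\<close> and \<open>q\<close> are as in
  \<open>block_excess_bound\<close>.
\<close>
lemma excess_expectation: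
  assumes t: "t < m" and S: "integrable M (\<lambda>\<omega>. (S \<omega> - \<sigma>\<^sup>2)\<^sup>2)"
    and V: "real p * expectation (\<lambda>\<omega>. (S \<omega> - \<sigma>\<^sup>2)\<^sup>2) \<le> K * \<sigma> ^ 4" and K: "0 \<le> K"
  shows "integrable M (excess \<theta> S t)"
    and "expectation (excess \<theta> S t) \<le> (7 * (2 * \<kappa> + 4) * \<sigma>\<^sup>2 + 1) / real n
      + 3 * K * \<sigma>\<^sup>2 / (real n * real p) * (real (J (Suc t)) - real (J t))"
proof -
  let ?B = "block t"
  define k where "k = real (card ?B)"
  define a where "a = (\<Sum>j\<in>?B. (\<theta> j)\<^sup>2)"
  define D where "D = a + \<sigma>\<^sup>2 * k / real n + 1 / real n"
  define l where "l \<omega> = (\<Sum>j\<in>?B. \<theta> j * err j \<omega>)" for \<omega>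
  define q where "q \<omega> = (\<Sum>j\<in>?B. (err j \<omega>)\<^sup>2) - \<sigma>\<^sup>2 * real (card ?B) / real n" for \<omega>
  define V where "V = expectation (\<lambda>\<omega>. (S \<omega> - \<sigma>\<^sup>2)\<^sup>2)"
  note B = block_subset[OF t]
  have k: "k = real (J (Suc t)) - real (J t)" "0 \<le> k"
    using J_Suc[OF t] by (auto simp: k_def block_def of_nat_diff)
  have a: "0 \<le> a" unfolding a_def by (intro sum_nonneg) auto
  have n: "0 < real n" and p: "0 < real p" using dims by auto
  have D: "0 < D" "a + \<sigma>\<^sup>2 * k / real n \<le> D" "\<sigma>\<^sup>2 * k / real n \<le> D"
    using a k(2) n by (auto simp: D_def intro!: add_nonneg_pos add_nonneg_nonneg)
  have excess: "excess \<theta> S t \<omega> = (12 * (l \<omega>)\<^sup>2 + 7 * (q \<omega>)\<^sup>2 + 3 * (k / real n)\<^sup>2 * (S \<omega> - \<sigma>\<^sup>2)\<^sup>2) / D + 1 / real n" for \<omega>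
    by (simp add: excess_def l_def q_def D_def a_def k_def power_divide power_mult_distrib)
  have l: "integrable M (\<lambda>\<omega>. (l \<omega>)\<^sup>2)" "expectation (\<lambda>\<omega>. (l \<omega>)\<^sup>2) = \<sigma>\<^sup>2 / real n * a"
    using square_integrable_linear_err[of \<theta> ?B] linear_err_second_moment[OF B, of \<theta>]
    by (auto simp: square_integrable_def l_def a_def)
  have q: "integrable M (\<lambda>\<omega>. (q \<omega>)\<^sup>2)" "expectation (\<lambda>\<omega>. (q \<omega>)\<^sup>2) \<le> (2 * \<kappa> + 4) * \<sigma> ^ 4 * k / (real n)\<^sup>2"
    using square_err_moments[OF B] by (auto simp: square_integrable_def q_def k_def)
  show "integrable M (excess \<theta> S t)" unfolding excess[abs_def] using l q S by simp
  have "expectation (excess \<theta> S t) = (12 * (\<sigma>\<^sup>2 / real n * a) + 7 * expectation (\<lambda>\<omega>. (q \<omega>)\<^sup>2) + 3 * (k / real n)\<^sup>2 * V) / D + 1 / real n"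
    unfolding excess[abs_def] using l q S by (simp add: prob_space V_def)
  also have "\<dots> \<le> (7 * (2 * \<kappa> + 4) * \<sigma>\<^sup>2 / real n * D + 3 * K * \<sigma>\<^sup>2 / (real n * real p) * k * D) / D + 1 / real n"
  proof (intro add_right_mono divide_right_mono)
    have "12 * (\<sigma>\<^sup>2 / real n * a) \<le> 7 * (2 * \<kappa> + 4) * (\<sigma>\<^sup>2 / real n * a)"
      using kappa_nonneg a n by (intro mult_right_mono mult_nonneg_nonneg) auto
    moreover have "7 * expectation (\<lambda>\<omega>. (q \<omega>)\<^sup>2) \<le> 7 * (2 * \<kappa> + 4) * (\<sigma>\<^sup>2 / real n * (\<sigma>\<^sup>2 * k / real n))"
    proof -
      define Z where "Z = \<sigma>\<^sup>2 / real n * (\<sigma>\<^sup>2 * k / real n)"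
      have "(2 * \<kappa> + 4) * \<sigma> ^ 4 * k / (real n)\<^sup>2 = (2 * \<kappa> + 4) * Z"
        by (simp add: Z_def power2_eq_square power4_eq_xxxx)
      then show ?thesis using q(2) unfolding Z_def[symmetric] by (simp add: algebra_simps)
    qed
    ultimately have "12 * (\<sigma>\<^sup>2 / real n * a) + 7 * expectation (\<lambda>\<omega>. (q \<omega>)\<^sup>2)
        \<le> 7 * (2 * \<kappa> + 4) * (\<sigma>\<^sup>2 / real n * a) + 7 * (2 * \<kappa> + 4) * (\<sigma>\<^sup>2 / real n * (\<sigma>\<^sup>2 * k / real n))"
      by (rule add_mono)
    also have "\<dots> = 7 * (2 * \<kappa> + 4) * \<sigma>\<^sup>2 / real n * (a + \<sigma>\<^sup>2 * k / real n)"
    proof -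
      have "c * (s / real n * x) + c * (s / real n * y) = c * s / real n * (x + y)" for c s x y :: real
        by (simp add: distrib_left add_divide_distrib)
      then show ?thesis .
    qed
    also have "\<dots> \<le> 7 * (2 * \<kappa> + 4) * \<sigma>\<^sup>2 / real n * D"
      using D(2) kappa_nonneg by (intro mult_left_mono) auto
    finally have 1: "12 * (\<sigma>\<^sup>2 / real n * a) + 7 * expectation (\<lambda>\<omega>. (q \<omega>)\<^sup>2) \<le> 7 * (2 * \<kappa> + 4) * \<sigma>\<^sup>2 / real n * D" .
    have "V \<le> K * \<sigma> ^ 4 / real p" using V p by (simp add: V_def field_simps)
    then have "3 * (k / real n)\<^sup>2 * V \<le> 3 * (k / real n)\<^sup>2 * (K * \<sigma> ^ 4 / real p)"
      by (intro mult_left_mono) auto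
    also have "\<dots> = 3 * K * \<sigma>\<^sup>2 / (real n * real p) * k * (\<sigma>\<^sup>2 * k / real n)"
      by (simp add: power2_eq_square power4_eq_xxxx mult_ac)
    also have "\<dots> \<le> 3 * K * \<sigma>\<^sup>2 / (real n * real p) * k * D"
      using D(3) K k(2) by (intro mult_left_mono mult_nonneg_nonneg divide_nonneg_nonneg) auto
    finally show "12 * (\<sigma>\<^sup>2 / real n * a) + 7 * expectation (\<lambda>\<omega>. (q \<omega>)\<^sup>2) + 3 * (k / real n)\<^sup>2 * V
        \<le> 7 * (2 * \<kappa> + 4) * \<sigma>\<^sup>2 / real n * D + 3 * K * \<sigma>\<^sup>2 / (real n * real p) * k * D"
      using 1 by linarith
  qed (use D in simp)
  also have "\<dots> = (7 * (2 * \<kappa> + 4) * \<sigma>\<^sup>2 + 1) / real n + 3 * K * \<sigma>\<^sup>2 / (real n * real p) * k"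
  proof -
    have "(x * D + y * D) / D = x + y" for x y using D(1) by (simp add: add_divide_distrib)
    then show ?thesis by (simp add: add_divide_distrib)
  qed
  finally show "expectation (excess \<theta> S t) \<le> (7 * (2 * \<kappa> + 4) * \<sigma>\<^sup>2 + 1) / real n
      + 3 * K * \<sigma>\<^sup>2 / (real n * real p) * (real (J (Suc t)) - real (J t))"
    unfolding k(1) .
qed

text \<open>
  The loss of the MMA estimator has an integrable majorant, the loss for the weights \<open>v\<close> plus the excess of each block;
  the block sizes in the bounds on the expected excess add up to \<open>p\<close>.
\<close>
theorem mma_oracle_inequality:
  assumes min: "\<And>y. y \<in> carrier_vec n \<Longrightarrow> is_arg_min (mallows_criterion n \<psi> models (s y) y) (\<lambda>v. v \<in> weights models) (w y)"
    and S: "integrable M (\<lambda>\<omega>. (s (obs n \<epsilon> (comb \<theta>) \<omega>) - \<sigma>\<^sup>2)\<^sup>2)"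
      "real p * expectation (\<lambda>\<omega>. (s (obs n \<epsilon> (comb \<theta>) \<omega>) - \<sigma>\<^sup>2)\<^sup>2) \<le> K * \<sigma> ^ 4" and K: "0 \<le> K"
    and v: "v \<in> weights models"
  shows "risk M n \<epsilon> (\<lambda>y. avg_est n \<psi> models (w y) y) (comb \<theta>)
    \<le> risk M n \<epsilon> (avg_est n \<psi> models v) (comb \<theta>)
      + (real m * (7 * (2 * \<kappa> + 4) * \<sigma>\<^sup>2 + 1) + 3 * K * \<sigma>\<^sup>2) / real n"
proof -
  define T where "T \<omega> = s (obs n \<epsilon> (comb \<theta>) \<omega>)" for \<omega>
  let ?l = "\<lambda>\<omega>. loss n (avg_est n \<psi> models v (obs n \<epsilon> (comb \<theta>) \<omega>)) (comb \<theta>)"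
  note int_l = integrable_loss[OF finite_models models_subset, of v \<theta>]
  note ex = excess_expectation[of _ T, OF _ S[folded T_def] K, of _ \<theta>]
  have n: "0 < real n" and p: "0 < real p" using dims by auto
  have int_sum: "integrable M (\<lambda>\<omega>. \<Sum>t<m. excess \<theta> T t \<omega>)"
    using ex(1) by (intro Bochner_Integration.integrable_sum) auto
  have "risk M n \<epsilon> (\<lambda>y. avg_est n \<psi> models (w y) y) (comb \<theta>) \<le> expectation (\<lambda>\<omega>. ?l \<omega> + (\<Sum>t<m. excess \<theta> T t \<omega>))"
    unfolding risk_def
  proof (rule integral_mono')
    show "integrable M (\<lambda>\<omega>. ?l \<omega> + (\<Sum>t<m. excess \<theta> T t \<omega>))"
      using int_l int_sum by (rule Bochner_Integration.integrable_add)
    fix \<omega>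
    show "loss n (avg_est n \<psi> models (w (obs n \<epsilon> (comb \<theta>) \<omega>)) (obs n \<epsilon> (comb \<theta>) \<omega>)) (comb \<theta>)
        \<le> ?l \<omega> + (\<Sum>t<m. excess \<theta> T t \<omega>)"
      by (rule mma_loss_le_excess[OF _ v]) (simp only: T_def min obs_carrier)
    have "0 \<le> ?l \<omega>"
      unfolding loss_avg_est[OF finite_models models_subset obs_carrier] by (intro sum_nonneg) auto
    then show "0 \<le> ?l \<omega> + (\<Sum>t<m. excess \<theta> T t \<omega>)"
      using excess_nonneg by (intro add_nonneg_nonneg sum_nonneg)
  qed
  also have "\<dots> = risk M n \<epsilon> (avg_est n \<psi> models v) (comb \<theta>) + (\<Sum>t<m. expectation (excess \<theta> T t))"
    unfolding risk_def Bochner_Integration.integral_add[OF int_l int_sum]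
    by (subst Bochner_Integration.integral_sum) (use ex(1) in auto)
  also have "(\<Sum>t<m. expectation (excess \<theta> T t)) \<le> (\<Sum>t<m. (7 * (2 * \<kappa> + 4) * \<sigma>\<^sup>2 + 1) / real n
      + 3 * K * \<sigma>\<^sup>2 / (real n * real p) * (real (J (Suc t)) - real (J t)))"
    using ex(2) by (intro sum_mono) auto
  also have "\<dots> = real m * ((7 * (2 * \<kappa> + 4) * \<sigma>\<^sup>2 + 1) / real n) + 3 * K * \<sigma>\<^sup>2 / (real n * real p) * real p"
    unfolding sum.distrib sum_distrib_left[symmetric] sum_block_sizes by simp
  also have "\<dots> = (real m * (7 * (2 * \<kappa> + 4) * \<sigma>\<^sup>2 + 1) + 3 * K * \<sigma>\<^sup>2) / real n"
    using n p by (simp add: add_divide_distrib distrib_left)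
  finally show ?thesis by simp
qed

end

section \<open>The group-wise nested models\<close>

text \<open>
  If \<open>\<sigma> = 0\<close> then the noise vanishes almost surely, so the constant \<open>0\<close> serves; otherwise \<open>\<nu> / \<sigma> ^ 4\<close> does.
\<close>
lemma fourth_moment_scale:
  assumes "0 < \<nu>"
  obtains \<kappa> :: real where "0 \<le> \<kappa>"
    "\<And>M \<epsilon>. integrable M (\<lambda>\<omega>. (\<epsilon> \<omega>)\<^sup>2) \<Longrightarrow> integral\<^sup>L M (\<lambda>\<omega>. (\<epsilon> \<omega>)\<^sup>2) = \<sigma>\<^sup>2 \<Longrightarrow>
      \<epsilon> \<in> borel_measurable M \<Longrightarrow> integral\<^sup>L M (\<lambda>\<omega>. \<epsilon> \<omega> ^ 4) \<le> \<nu> \<Longrightarrow>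
      integral\<^sup>L M (\<lambda>\<omega>. (\<epsilon> \<omega> :: real) ^ 4) \<le> \<kappa> * \<sigma> ^ 4"
proof (cases "\<sigma> = 0")
  case True
  have "integral\<^sup>L M (\<lambda>\<omega>. \<epsilon> \<omega> ^ 4) \<le> 0 * \<sigma> ^ 4"
    if "integrable M (\<lambda>\<omega>. (\<epsilon> \<omega>)\<^sup>2)" "integral\<^sup>L M (\<lambda>\<omega>. (\<epsilon> \<omega>)\<^sup>2) = \<sigma>\<^sup>2" "\<epsilon> \<in> borel_measurable M"
    for M :: "'b measure" and \<epsilon>
  proof -
    have "AE \<omega> in M. (\<epsilon> \<omega>)\<^sup>2 = 0"
      using that True integral_nonneg_eq_0_iff_AE[OF that(1)] by simp
    then have "AE \<omega> in M. \<epsilon> \<omega> ^ 4 = 0" by eventually_elim simp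
    then have "integral\<^sup>L M (\<lambda>\<omega>. \<epsilon> \<omega> ^ 4) = 0" by (rule integral_eq_zero_AE)
    then show ?thesis by simp
  qed
  then show thesis by (intro that[of 0]) auto
next
  case False
  then show thesis using assms by (intro that[of "\<nu> / \<sigma> ^ 4"]) auto
qed

theorem corollary2:
  fixes M :: "nat \<Rightarrow> 'a measure"
    and \<epsilon> :: "nat \<Rightarrow> nat \<Rightarrow> 'a \<Rightarrow> real"
    and \<sigma> \<nu> :: real
    and p :: "nat \<Rightarrow> nat"
    and \<psi> :: "nat \<Rightarrow> nat \<Rightarrow> real vec"
    and s2hat :: "nat \<Rightarrow> real vec \<Rightarrow> real"
    and what :: "nat \<Rightarrow> real vec \<Rightarrow> nat set \<Rightarrow> real"
  assumes design: "\<And>n. 2 \<le> n \<Longrightarrow> orthogonal_design n (p n) (\<psi> n)"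
    and noise: "\<And>n. 2 \<le> n \<Longrightarrow> noise (M n) n (\<epsilon> n) \<sigma>"
    and nu_pos: "0 < \<nu>"
    and fourth_moment: "\<And>n i. 2 \<le> n \<Longrightarrow> i < n \<Longrightarrow>
          integrable (M n) (\<lambda>\<omega>. \<epsilon> n i \<omega> ^ 4) \<and> prob_space.expectation (M n) (\<lambda>\<omega>. \<epsilon> n i \<omega> ^ 4) \<le> \<nu>"
    and variance_estimator:
      "(\<forall>n\<ge>2. \<forall>y\<in>carrier_vec n. s2hat n y = \<sigma>\<^sup>2) \<or>
       ((\<forall>n\<ge>2. \<forall>\<theta>. let S = (\<lambda>\<omega>. s2hat n (obs n (\<epsilon> n) (mean_vec n (p n) (\<psi> n) \<theta>) \<omega>)) in
            integrable (M n) S \<and> prob_space.expectation (M n) S = \<sigma>\<^sup>2) \<and>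
        (\<exists>K. \<forall>n\<ge>2. \<forall>\<theta>. let S = (\<lambda>\<omega>. s2hat n (obs n (\<epsilon> n) (mean_vec n (p n) (\<psi> n) \<theta>) \<omega>)) in
            integrable (M n) (\<lambda>\<omega>. (S \<omega> - \<sigma>\<^sup>2)\<^sup>2) \<and>
            real (p n) * prob_space.variance (M n) S \<le> K * \<sigma> ^ 4 * ln (real (p n)) ^ 4))"
    and mma: "\<And>n. 2 \<le> n \<Longrightarrow> is_mma_weight_rule n (\<psi> n) (group_nested (p n)) (s2hat n) (what n)"
    and mma_measurable: "\<And>n \<theta> I. 2 \<le> n \<Longrightarrow> I \<in> group_nested (p n) \<Longrightarrow>
          (\<lambda>\<omega>. what n (obs n (\<epsilon> n) (mean_vec n (p n) (\<psi> n) \<theta>) \<omega>) I) \<in> borel_measurable (M n)"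
  shows "\<exists>C>0. \<exists>\<delta>::nat \<Rightarrow> real. \<delta> \<longlonglongrightarrow> 0 \<and>
           (\<forall>n\<ge>2. \<forall>\<theta>. let \<mu> = mean_vec n (p n) (\<psi> n) \<theta> in
              risk (M n) n (\<epsilon> n) (\<lambda>y. avg_est n (\<psi> n) (group_nested (p n)) (what n y) y) \<mu>
              \<le> (1 + \<delta> n) * (1 + 1 / ln (real (p n))) *
                  oracle_risk (M n) n (\<epsilon> n) (\<psi> n) (all_nested (p n)) \<mu>
                + C * ln (real (p n)) ^ 4 / real n)"
proof -
  obtain \<kappa> :: real where kappa: "0 \<le> \<kappa>"
    "\<And>(N :: 'a measure) \<eta>. integrable N (\<lambda>\<omega>. (\<eta> \<omega>)\<^sup>2) \<Longrightarrow> integral\<^sup>L N (\<lambda>\<omega>. (\<eta> \<omega>)\<^sup>2) = \<sigma>\<^sup>2 \<Longrightarrow>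
      \<eta> \<in> borel_measurable N \<Longrightarrow> integral\<^sup>L N (\<lambda>\<omega>. \<eta> \<omega> ^ 4) \<le> \<nu> \<Longrightarrow> integral\<^sup>L N (\<lambda>\<omega>. \<eta> \<omega> ^ 4) \<le> \<kappa> * \<sigma> ^ 4"
    using fourth_moment_scale[OF nu_pos, of \<sigma>] by metis
  define S where "S n \<theta> \<omega> = s2hat n (obs n (\<epsilon> n) (mean_vec n (p n) (\<psi> n) \<theta>) \<omega>)" for n \<theta> \<omega>
  have S_ex: "\<exists>K\<ge>0. \<forall>n\<ge>2. \<forall>\<theta>. integrable (M n) (\<lambda>\<omega>. (S n \<theta> \<omega> - \<sigma>\<^sup>2)\<^sup>2) \<and>
      real (p n) * prob_space.expectation (M n) (\<lambda>\<omega>. (S n \<theta> \<omega> - \<sigma>\<^sup>2)\<^sup>2) \<le> K * ln (real (p n)) ^ 4 * \<sigma> ^ 4"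
    using variance_estimator
  proof
    assume known: "\<forall>n\<ge>2. \<forall>y\<in>carrier_vec n. s2hat n y = \<sigma>\<^sup>2"
    have "S n \<theta> \<omega> = \<sigma>\<^sup>2" if n: "2 \<le> n" for n \<theta> \<omega>
    proof -
      interpret orthogonal_regression n "p n" "\<psi> n" by unfold_locales (rule design[OF n])
      have "obs n (\<epsilon> n) (mean_vec n (p n) (\<psi> n) \<theta>) \<omega> \<in> carrier_vec n"
        by (simp add: obs_def mean_vec_comb)
      then show ?thesis using known n by (simp add: S_def)
    qed
    then show ?thesis by (intro exI[of _ 0]) simp
  next
    assume unbiased: "(\<forall>n\<ge>2. \<forall>\<theta>. let S = (\<lambda>\<omega>. s2hat n (obs n (\<epsilon> n) (mean_vec n (p n) (\<psi> n) \<theta>) \<omega>)) in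
            integrable (M n) S \<and> prob_space.expectation (M n) S = \<sigma>\<^sup>2) \<and>
        (\<exists>K. \<forall>n\<ge>2. \<forall>\<theta>. let S = (\<lambda>\<omega>. s2hat n (obs n (\<epsilon> n) (mean_vec n (p n) (\<psi> n) \<theta>) \<omega>)) in
            integrable (M n) (\<lambda>\<omega>. (S \<omega> - \<sigma>\<^sup>2)\<^sup>2) \<and>
            real (p n) * prob_space.variance (M n) S \<le> K * \<sigma> ^ 4 * ln (real (p n)) ^ 4)"
    then obtain K where K: "\<And>n \<theta>. 2 \<le> n \<Longrightarrow> integrable (M n) (\<lambda>\<omega>. (S n \<theta> \<omega> - \<sigma>\<^sup>2)\<^sup>2) \<and>
            real (p n) * prob_space.variance (M n) (S n \<theta>) \<le> K * \<sigma> ^ 4 * ln (real (p n)) ^ 4"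
      unfolding Let_def S_def[abs_def] by blast
    have mean: "prob_space.expectation (M n) (S n \<theta>) = \<sigma>\<^sup>2" if "2 \<le> n" for n \<theta>
      using unbiased that unfolding Let_def S_def[abs_def] by blast
    have "real (p n) * prob_space.expectation (M n) (\<lambda>\<omega>. (S n \<theta> \<omega> - \<sigma>\<^sup>2)\<^sup>2) \<le> \<bar>K\<bar> * ln (real (p n)) ^ 4 * \<sigma> ^ 4"
      if "2 \<le> n" for n \<theta>
    proof -
      have "real (p n) * prob_space.expectation (M n) (\<lambda>\<omega>. (S n \<theta> \<omega> - \<sigma>\<^sup>2)\<^sup>2) \<le> K * (\<sigma> ^ 4 * ln (real (p n)) ^ 4)"
        using K[OF that, of \<theta>] unfolding mean[OF that] by (simp add: mult.assoc)
      also have "\<dots> \<le> \<bar>K\<bar> * (\<sigma> ^ 4 * ln (real (p n)) ^ 4)"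
        by (intro mult_right_mono) auto
      finally show ?thesis by (simp add: mult_ac)
    qed
    then show ?thesis using K by (intro exI[of _ "\<bar>K\<bar>"]) simp
  qed
  then obtain K where K: "0 \<le> K" "\<And>n \<theta>. 2 \<le> n \<Longrightarrow> integrable (M n) (\<lambda>\<omega>. (S n \<theta> \<omega> - \<sigma>\<^sup>2)\<^sup>2)"
    "\<And>n \<theta>. 2 \<le> n \<Longrightarrow> real (p n) * prob_space.expectation (M n) (\<lambda>\<omega>. (S n \<theta> \<omega> - \<sigma>\<^sup>2)\<^sup>2)
      \<le> K * ln (real (p n)) ^ 4 * \<sigma> ^ 4"
    by blast
  define c where "c = 7 * (2 * \<kappa> + 4) * \<sigma>\<^sup>2 + 1"
  \<comment> \<open>in this order: the cost of the groups, the error of the variance estimator, and the rounding up\<close>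
  define C where "C = 44 * c + 3 * K * \<sigma>\<^sup>2 + 112 * \<sigma>\<^sup>2"
  have c: "0 < c" unfolding c_def using kappa(1) by (intro add_nonneg_pos mult_nonneg_nonneg) auto
  have "risk (M n) n (\<epsilon> n) (\<lambda>y. avg_est n (\<psi> n) (group_nested (p n)) (what n y) y) (mean_vec n (p n) (\<psi> n) \<theta>)
      \<le> (1 + 0) * (1 + 1 / ln (real (p n))) *
          oracle_risk (M n) n (\<epsilon> n) (\<psi> n) (all_nested (p n)) (mean_vec n (p n) (\<psi> n) \<theta>)
        + C * ln (real (p n)) ^ 4 / real n" if n: "2 \<le> n" for n \<theta>
  proof -
    let ?L = "ln (real (p n))" and ?J = "block_end (p n)" and ?m = "group_count (p n)"
    interpret N: prob_space "M n" using noise[OF n] by (simp add: noise_def)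
    interpret D: orthogonal_regression n "p n" "\<psi> n" by unfold_locales (rule design[OF n])
    interpret G: group_sizes "p n" by unfold_locales (rule D.dims)
    have noise': "N.indep_vars (\<lambda>_. borel) (\<epsilon> n) {..<n}"
      "\<And>i. i < n \<Longrightarrow> integrable (M n) (\<lambda>\<omega>. (\<epsilon> n i \<omega>)\<^sup>2)" "\<And>i. i < n \<Longrightarrow> N.expectation (\<epsilon> n i) = 0"
      "\<And>i. i < n \<Longrightarrow> N.expectation (\<lambda>\<omega>. (\<epsilon> n i \<omega>)\<^sup>2) = \<sigma>\<^sup>2"
      using noise[OF n] by (auto simp: noise_def)
    have meas: "\<epsilon> n i \<in> borel_measurable (M n)" if "i < n" for i
      using noise'(1) that by (auto simp: N.indep_vars_def)
    interpret R: nested_regression n "p n" "\<psi> n" "M n" "\<epsilon> n" \<sigma> \<kappa> ?J ?m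
      by unfold_locales
        (use noise' fourth_moment[OF n] kappa meas G.block_end_0 G.block_end_count G.block_end_mono in auto)
    let ?\<mu> = "mean_vec n (p n) (\<psi> n) \<theta>"
    let ?risk = "risk (M n) n (\<epsilon> n) (\<lambda>y. avg_est n (\<psi> n) (group_nested (p n)) (what n y) y) ?\<mu>"
    have models: "group_nested (p n) = R.models"
      by (simp add: G.group_nested_eq R.models_def)
    have \<mu>: "?\<mu> = D.comb \<theta>" by (rule D.mean_vec_comb)
    have L: "0 < ?L" using G.L_ge by simp
    have nn: "0 < real n" using n by simp
    have bound: "?risk \<le> (1 + 1 / ?L) * risk (M n) n (\<epsilon> n) (avg_est n (\<psi> n) (all_nested (p n)) w) ?\<mu> + C * ?L ^ 4 / real n"
      if w: "w \<in> weights (all_nested (p n))" for w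
    proof -
      have "?risk \<le> risk (M n) n (\<epsilon> n) (avg_est n (\<psi> n) R.models (R.round_up w)) ?\<mu>
          + (real ?m * c + 3 * (K * ?L ^ 4) * \<sigma>\<^sup>2) / real n"
        unfolding models \<mu> c_def
      proof (rule R.mma_oracle_inequality)
        show "is_arg_min (mallows_criterion n (\<psi> n) R.models (s2hat n y) y) (\<lambda>v. v \<in> weights R.models) (what n y)"
          if "y \<in> carrier_vec n" for y
          using mma[OF n] that by (simp add: is_mma_weight_rule_def models)
        show "integrable (M n) (\<lambda>\<omega>. (s2hat n (obs n (\<epsilon> n) (D.comb \<theta>) \<omega>) - \<sigma>\<^sup>2)\<^sup>2)"
          using K(2)[OF n, of \<theta>] by (simp add: S_def \<mu>)
        show "real (p n) * N.expectation (\<lambda>\<omega>. (s2hat n (obs n (\<epsilon> n) (D.comb \<theta>) \<omega>) - \<sigma>\<^sup>2)\<^sup>2) \<le> K * ?L ^ 4 * \<sigma> ^ 4"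
          using K(3)[OF n, of \<theta>] by (simp add: S_def \<mu>)
        show "0 \<le> K * ?L ^ 4" using K(1) by simp
        show "R.round_up w \<in> weights R.models" by (rule R.round_up_weights[OF w])
      qed
      also have "risk (M n) n (\<epsilon> n) (avg_est n (\<psi> n) R.models (R.round_up w)) ?\<mu>
          \<le> (1 + group_rho (p n)) * risk (M n) n (\<epsilon> n) (avg_est n (\<psi> n) (all_nested (p n)) w) ?\<mu>
            + \<sigma>\<^sup>2 * (112 * ?L ^ 4) / real n"
        unfolding \<mu> using G.rho_pos G.group_count(1) G.block_end_step by (intro R.risk_round_up w) auto
      also have "real ?m * c \<le> 44 * ?L ^ 4 * c"
        using G.group_count_le c by (intro mult_right_mono) auto
      finally have "?risk \<le> (1 + group_rho (p n)) * risk (M n) n (\<epsilon> n) (avg_est n (\<psi> n) (all_nested (p n)) w) ?\<mu>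
          + (\<sigma>\<^sup>2 * (112 * ?L ^ 4) / real n + (44 * ?L ^ 4 * c + 3 * (K * ?L ^ 4) * \<sigma>\<^sup>2) / real n)"
        using nn by (simp add: divide_right_mono)
      also have "\<sigma>\<^sup>2 * (112 * ?L ^ 4) / real n + (44 * ?L ^ 4 * c + 3 * (K * ?L ^ 4) * \<sigma>\<^sup>2) / real n = C * ?L ^ 4 / real n"
        unfolding add_divide_distrib[symmetric] by (simp add: C_def algebra_simps)
      finally show ?thesis by (simp only: group_rho_def)
    qed
    have "weights (all_nested (p n)) \<noteq> {}"
    proof -
      \<comment> \<open>all weight on the full model\<close>
      have "(\<lambda>I. if I = {1..p n} then 1 else 0) \<in> weights (all_nested (p n))"
        using D.dims by (auto simp: weights_def all_nested_def)
      then show ?thesis by blast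
    qed
    moreover have "(?risk - C * ?L ^ 4 / real n) / (1 + 1 / ?L)
        \<le> risk (M n) n (\<epsilon> n) (avg_est n (\<psi> n) (all_nested (p n)) w) ?\<mu>" if "w \<in> weights (all_nested (p n))" for w
      using bound[OF that] L by (subst pos_divide_le_eq) (auto simp: add_pos_pos mult.commute)
    ultimately have "(?risk - C * ?L ^ 4 / real n) / (1 + 1 / ?L) \<le> oracle_risk (M n) n (\<epsilon> n) (\<psi> n) (all_nested (p n)) ?\<mu>"
      unfolding oracle_risk_def by (rule cINF_greatest)
    moreover have "0 < 1 + 1 / ?L" using L by (simp add: add_pos_pos)
    ultimately have "?risk - C * ?L ^ 4 / real n \<le> oracle_risk (M n) n (\<epsilon> n) (\<psi> n) (all_nested (p n)) ?\<mu> * (1 + 1 / ?L)"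
      by (simp only: pos_divide_le_eq)
    then show ?thesis by (simp add: mult.commute)
  qed
  moreover have "0 < C" unfolding C_def using c K(1) by (intro add_pos_nonneg mult_nonneg_nonneg) auto
  moreover have "(\<lambda>_. 0 :: real) \<longlonglongrightarrow> 0" by simp
  ultimately show ?thesis unfolding Let_def by (intro exI[of _ C] conjI exI[of _ "\<lambda>_. 0"]) auto
qed

end
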